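(* Let $R(p) := 1 + \frac{1}{4}p^2+\frac{1}{2}p(1-p) + \frac{9}{64}p^{4}+ \frac{9}{16}p^{3}(1-p)+\frac{3}{8} p^2(1-p)^2$, and let $p_1 = 0.7805\dots$ denote the root in $(0,1)$ of the equation $\pi p\sqrt{3-2p}\,R(p) = 4$. If $p > p_1$, then for every sequence of instructions and every location $x_{\mathrm{home}} \in \mathbb{Z}^2\setminus\{0\}$ of home, the hitting time $T$ of the guided random walk satisfies $\mathbb{E}[T] = \infty$.
   Context: Fix $p\in[0,1]$. A sequence of instructions is an infinite walk $(x_t)_{t\ge 0}$ in $\mathbb{Z}^2$ with $x_0=0$ and $x_{t+1}-x_t\in\{(\pm1,0),(0,\pm1)\}$; it may depend on the location $x_{\mathrm{home}}\in\mathbb{Z}^2$ of home. The guided random walk following these instructions is the Markov chain $(X_t)_{t\ge0}$ with $X_0=0$ and, independently at each step, $X_{t+1}-X_t = x_{t+1}-x_t$ with probability $1-p$, and $X_{t+1}-X_t$ uniformly distributed on $\{(\pm1,0),(0,\pm1)\}$ with probability $p$. The hitting time is $T:=\inf\{t\ge 0 : X_t = x_{\mathrm{home}}\}$. *)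

theory Defs
  imports "HOL-Probability.Probability"
begin

type_synonym pt = "int \<times> int"

definition unit_steps :: "pt set" where
  "unit_steps = {(1,0), (-1,0), (0,1), (0,-1)}"

definition vsub :: "pt \<Rightarrow> pt \<Rightarrow> pt" where
  "vsub a b = (fst a - fst b, snd a - snd b)"

definition vadd :: "pt \<Rightarrow> pt \<Rightarrow> pt" where
  "vadd a b = (fst a + fst b, snd a + snd b)"

definition instructions :: "(nat \<Rightarrow> pt) \<Rightarrow> bool" where
  "instructions x \<longleftrightarrow> x 0 = (0,0) \<and> (\<forall>t. vsub (x (Suc t)) (x t) \<in> unit_steps)"

definition step_pmf :: "real \<Rightarrow> (nat \<Rightarrow> pt) \<Rightarrow> nat \<Rightarrow> pt pmf" where
  "step_pmf p x t = bind_pmf (bernoulli_pmf p)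
      (\<lambda>b. if b then pmf_of_set unit_steps else return_pmf (vsub (x (Suc t)) (x t)))"

definition guided_space :: "real \<Rightarrow> (nat \<Rightarrow> pt) \<Rightarrow> (nat \<Rightarrow> pt) measure" where
  "guided_space p x = PiM UNIV (\<lambda>t. measure_pmf (step_pmf p x t))"

fun walk_pos :: "(nat \<Rightarrow> pt) \<Rightarrow> nat \<Rightarrow> pt" where
  "walk_pos \<omega> 0 = (0,0)"
| "walk_pos \<omega> (Suc n) = vadd (walk_pos \<omega> n) (\<omega> n)"

definition hitting_time :: "pt \<Rightarrow> (nat \<Rightarrow> pt) \<Rightarrow> ennreal" where
  "hitting_time h \<omega> =
     (if \<exists>n. walk_pos \<omega> n = h then of_nat (LEAST n. walk_pos \<omega> n = h) else \<infinity>)"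

definition R_poly :: "real \<Rightarrow> real" where
  "R_poly p = 1 + 1/4 * p^2 + 1/2 * p * (1-p) + 9/64 * p^4 + 9/16 * p^3 * (1-p)
              + 3/8 * p^2 * (1-p)^2"

definition p1 :: real where
  "p1 = (THE p. 0 < p \<and> p < 1 \<and> pi * p * sqrt (3 - 2*p) * R_poly p = 4)"

end

theory Submission
  imports Defs
begin

text \<open>
  Let \<open>a n = P (T > n)\<close> and \<open>f n = P (T = n)\<close>. Two facts about the chain are combined. First,
  after each visit of home the walk returns 2 and 4 steps later with probabilities at least
  \<open>r2\<close> and \<open>r4\<close>, where \<open>R = 1 + r2 + r4\<close>. Second, the probability of being in a given point
  after \<open>k\<close> steps is at most \<open>c / k\<close> for large \<open>k\<close>, for every
  \<open>c > 2 / (\<pi> p sqrt (3 - 2 p))\<close>: by Fourier inversion and the AM-GM inequality, it suffices to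
  consider constant instructions. Comparing the two at time \<open>t\<close>, given \<open>T > t - k\<close>, yields
  \<open>f t + r2 * f (t - 2) + r4 * f (t - 4) \<le> a (t - k) * c / k\<close>, and \<open>c = R / 2\<close> is admissible
  exactly if \<open>\<pi> p sqrt (3 - 2 p) R > 4\<close>. As \<open>f\<close> vanishes at times of one parity, a smoothed version
  \<open>B\<close> of \<open>a\<close> along the times of the other parity, with \<open>k = 2 m\<close>, satisfies the delay inequality
  \<open>B (n - 1) - B n \<le> B (n - m) / (4 m)\<close> for all large \<open>m \<le> n\<close>.

  For the delay \<open>m \<approx> n / 2\<close> this inequality is consistent with a decay like \<open>1 / n\<close>, but not with a
  faster one, unless \<open>B\<close> is already decaying fast at the start. The latter is excluded because
  \<open>a\<close> decays subexponentially: random steps alone can, in \<open>4 r\<close> steps, lead to about \<open>r\<^sup>2\<close> different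
  points, and from one of these home is avoided with probability at least \<open>1 / 2\<close> during the
  following \<open>r\<^sup>2 / 2\<close> steps.
  Hence \<open>B n * q ^ n\<close> is unbounded for every \<open>q > 1\<close>, so it has record times \<open>n0\<close>. From a record time on,
  the delay inequality shows that \<open>(K + n - n0) * B n\<close> is nondecreasing, so that
  \<open>E T = (\<Sum>n. a n)\<close> diverges.
\<close>

section \<open>A delay inequality\<close>

text \<open>Choose \<open>n\<close> with \<open>G n\<close> above all values up to \<open>K\<close>;
  a maximiser of \<open>G\<close> on \<open>{..n}\<close> must then lie beyond
  \<open>K\<close>.\<close>

lemma unbounded_record_time:
  fixes G :: "nat \<Rightarrow> real"
  assumes "\<And>C. \<exists>n. G n > C"
  obtains n0 where "K \<le> n0" "\<And>j. j \<le> n0 \<Longrightarrow> G j \<le> G n0"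
proof -
  obtain n where n: "G n > Max (G ` {..K})" using assms by blast
  have "Max (G ` {..n}) \<in> G ` {..n}" by (intro Max_in) auto
  then obtain n0 where n0: "n0 \<in> {..n}" "G n0 = Max (G ` {..n})"
    by (metis imageE)
  then have n0': "G j \<le> G n0" if "j \<le> n" for j using that by (auto intro: Max_ge)
  have "K \<le> n0"
  proof (rule ccontr)
    assume "\<not> K \<le> n0"
    then have "G n0 \<le> Max (G ` {..K})" by (intro Max_ge) auto
    with n n0'[of n] show False by linarith
  qed
  with n0 n0' show ?thesis by (intro that[of n0]) auto
qed

text \<open>From a record time \<open>n0\<close> on, \<open>B (n0 + i)\<close> is at least a
  constant times \<open>1 / (K + i)\<close>, so a harmonic series is a minorant. The claim
  \<open>main\<close> also covers the window of length \<open>K\<close> up to \<open>n0\<close>,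
  because the delayed argument \<open>n - m\<close> may lie before \<open>n0\<close>.\<close>

lemma delay_inequality_not_summable:
  fixes B :: "nat \<Rightarrow> real"
  assumes pos: "\<And>n. B n > 0"
    and delay: "\<And>n m. M \<le> m \<Longrightarrow> 1 \<le> m \<Longrightarrow> m \<le> n \<Longrightarrow> B (n - 1) - B n \<le> B (n - m) / (4 * real m)"
    and subexp: "\<And>q C. 1 < q \<Longrightarrow> \<exists>n. C < B n * q ^ n"
  shows "\<not> summable B"
proof -
  \<comment> \<open>Large enough that the delay \<open>u div 2\<close> chosen below is always
    positive and at least \<open>M\<close>.\<close>
  define K where "K = 2 * M + 2"
  \<comment> \<open>Here \<open>1 / q = 1 - 1 / K\<close>, so Bernoulli's inequality turns the
    record property into the linear weights of \<open>g\<close> on the window before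
    \<open>n0\<close>.\<close>
  define q where "q = real K / (real K - 1)"
  have K: "K \<ge> 2" by (simp add: K_def)
  have q: "q > 1" using K by (simp add: q_def field_simps)
  obtain n0 where n0: "K \<le> n0" and rec: "\<And>j. j \<le> n0 \<Longrightarrow> B j * q ^ j \<le> B n0 * q ^ n0"
    using unbounded_record_time[of "\<lambda>n. B n * q ^ n" K] subexp[OF q] by blast
  define g where "g j = (real K + real j - real n0) * B j" for j
  have main: "g j \<le> g (n0 + i)" if "n0 < j + K" "j \<le> n0 + i" for i j
    using that
  proof (induction i arbitrary: j)
    case 0
    define s where "s = n0 - j"
    have j: "j = n0 - s" "s \<le> n0" "s < K" using 0 by (auto simp: s_def)
    have "B j * q ^ j \<le> B n0 * (q ^ s * q ^ j)"
      using rec[of j] j by (simp add: power_add[symmetric])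
    then have Bj: "B j \<le> B n0 * q ^ s" using q by simp
    have "1 + real s * (-1 / real K) \<le> (1 + (-1 / real K)) ^ s"
      by (rule Bernoulli_inequality) (use K in \<open>simp add: field_simps\<close>)
    then have "(1 - real s / real K) * q ^ s \<le> (1 + (-1 / real K)) ^ s * q ^ s"
      using q by (intro mult_right_mono) auto
    also have "\<dots> = ((1 + (-1 / real K)) * q) ^ s" by (simp only: power_mult_distrib)
    also have "(1 + (-1 / real K)) * q = 1" using K by (simp add: q_def field_split_simps)
    finally have *: "(1 - real s / real K) * q ^ s \<le> 1" by simp
    have "g j = real K * ((1 - real s / real K) * B j)"
      using K j by (simp add: g_def of_nat_diff field_simps)
    also have "\<dots> \<le> real K * ((1 - real s / real K) * (B n0 * q ^ s))"
      using Bj j by (intro mult_left_mono) (auto simp: field_simps)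
    also have "\<dots> = real K * B n0 * ((1 - real s / real K) * q ^ s)" by simp
    also have "\<dots> \<le> real K * B n0 * 1"
      using pos[of n0] by (intro mult_left_mono *) auto
    finally show ?case by (simp add: g_def)
  next
    case (Suc i)
    \<comment> \<open>\<open>u\<close> is the weight of \<open>B n\<close> in \<open>g n\<close>,
      and \<open>u - m\<close> is the weight of \<open>B (n - m)\<close>.\<close>
    define u where "u = K + i + 1"
    define m where "m = u div 2"
    define n where "n = n0 + i + 1"
    have m: "M \<le> m" "1 \<le> m" "m \<le> n" "m < u" "n - m \<le> n0 + i" "n0 < n - m + K"
      using n0 by (auto simp: m_def u_def n_def K_def)
    have r1: "(real u - real m) * B (n - m) \<le> (real u - 1) * B (n0 + i)"
      using Suc.IH[of "n - m"] m by (simp add: g_def of_nat_diff u_def n_def algebra_simps)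
    \<comment> \<open>\<open>m = u div 2\<close> maximises \<open>m * (u - m)\<close>; with this
      choice the constant 4 of the delay hypothesis suffices.\<close>
    have um: "4 * real m * (real u - real m) \<ge> real u * (real u - 1)"
    proof -
      have "u = 2 * m \<or> u = 2 * m + 1" by (auto simp: m_def)
      then show ?thesis by (auto simp: algebra_simps)
    qed
    have "real u * B (n - m) * (4 * real m * (real u - real m))
        = 4 * real m * real u * ((real u - real m) * B (n - m))" by simp
    also have "\<dots> \<le> 4 * real m * real u * ((real u - 1) * B (n0 + i))"
      by (intro mult_left_mono r1) auto
    also have "\<dots> = 4 * real m * B (n0 + i) * (real u * (real u - 1))" by simp
    also have "\<dots> \<le> 4 * real m * B (n0 + i) * (4 * real m * (real u - real m))"
      using pos[of "n0 + i"] by (intro mult_left_mono um) auto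
    finally have "real u * B (n - m) \<le> 4 * real m * B (n0 + i)"
      by (rule mult_right_le_imp_le) (use m in auto)
    then have r2: "real u * (B (n - m) / (4 * real m)) \<le> B (n0 + i)"
      using m by (simp add: field_simps)
    have "B (n0 + i) - B n \<le> B (n - m) / (4 * real m)"
      using delay[of m n] m by (simp add: n_def)
    then have "real u * (B (n0 + i) - B n) \<le> B (n0 + i)"
      using r2 by (meson mult_left_mono of_nat_0_le_iff order_trans)
    then have step: "g (n0 + i) \<le> g n" by (simp add: g_def u_def n_def algebra_simps)
    show ?case
    proof (cases "j \<le> n0 + i")
      case True
      then show ?thesis using Suc.IH[of j] Suc.prems step by (simp add: n_def)
    next
      case False
      then have "j = n" using Suc.prems by (simp add: n_def)
      then show ?thesis by (simp add: n_def)
    qed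
  qed
  show ?thesis
  proof
    assume "summable B"
    then have "summable (\<lambda>i. B (i + n0))" by (simp only: summable_iff_shift)
    moreover have "norm (real K * B n0 * inverse (real (K + i))) \<le> B (i + n0)" for i
    proof -
      have "real K * B n0 \<le> B (i + n0) * real (K + i)"
        using main[of n0 i] K by (simp add: g_def ac_simps)
      moreover have "0 < real (K + i)" using K by simp
      ultimately have "real K * B n0 * inverse (real (K + i)) \<le> B (i + n0)"
        by (simp only: divide_inverse[symmetric] pos_divide_le_eq)
      moreover have "0 \<le> real K * B n0 * inverse (real (K + i))"
        using pos[of n0] by (simp add: less_imp_le)
      ultimately show ?thesis by (simp only: real_norm_def abs_of_nonneg)
    qed
    ultimately have "summable (\<lambda>i. real K * B n0 * inverse (real (K + i)))"
      by (rule summable_comparison_test'[where N = 0])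
    then have "summable (\<lambda>i. inverse (real (i + K)))"
      using pos[of n0] K unfolding summable_cmult_iff by (simp add: add.commute)
    then have "summable (\<lambda>i. inverse (real i))"
      by (rule summable_iff_shift[of "\<lambda>i. inverse (real i)" K, THEN iffD1])
    then show False using not_summable_harmonic[where 'a=real] by blast
  qed
qed

section \<open>The threshold\<close>

definition threshold_fun :: "real \<Rightarrow> real" where
  "threshold_fun p = pi * p * sqrt (3 - 2*p) * R_poly p"

lemma R_poly_ge_one: "0 \<le> p \<Longrightarrow> p \<le> 1 \<Longrightarrow> 1 \<le> R_poly p"
  by (simp add: R_poly_def)

lemma R_poly_mono:
  assumes "0 \<le> a" "a \<le> b" "b \<le> 1"
  shows "R_poly a \<le> R_poly b"
proof (rule DERIV_nonneg_imp_nondecreasing[OF assms(2)])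
  fix p :: real assume p: "a \<le> p" "p \<le> b"
  have "(R_poly has_real_derivative (1 - p) * (8 + 12 * p + 3 * p\<^sup>2) / 16) (at p)"
    unfolding R_poly_def[abs_def]
    by (rule derivative_eq_intros refl)+ (simp add: field_simps power2_eq_square power3_eq_cube)
  moreover have "(1 - p) * (8 + 12 * p + 3 * p\<^sup>2) / 16 \<ge> 0" using p assms by auto
  ultimately show "\<exists>y. DERIV R_poly p :> y \<and> 0 \<le> y" by blast
qed

text \<open>\<open>p * sqrt (3 - 2*p)\<close> is the square root of a cubic that increases strictly
  on the unit interval, and \<open>R_poly\<close> is positive and nondecreasing there. This serves
  both the uniqueness of the root and the bound \<open>threshold_fun p > 4\<close> beyond
  it.\<close>

lemma threshold_fun_strict_mono:
  assumes "0 \<le> a" "a < b" "b \<le> 1"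
  shows "threshold_fun a < threshold_fun b"
proof -
  have "b\<^sup>2 * (3 - 2*b) - a\<^sup>2 * (3 - 2*a) = (b - a) * (3 * (a + b) - 2 * (a\<^sup>2 + a * b + b\<^sup>2))"
    by (simp add: algebra_simps power2_eq_square)
  moreover have "0 < 3 * (a + b) - 2 * (a\<^sup>2 + a * b + b\<^sup>2)"
  proof -
    have "a * b < 1 * b" using assms by (intro mult_strict_right_mono) auto
    moreover have "a * a \<le> a * 1" "b * b \<le> b * 1" "a * b \<le> a * 1"
      by (intro mult_left_mono; use assms in linarith)+
    ultimately show ?thesis unfolding power2_eq_square distrib_left right_diff_distrib by linarith
  qed
  ultimately have "a\<^sup>2 * (3 - 2*a) < b\<^sup>2 * (3 - 2*b)"
    using assms(2) by (metis diff_gt_0_iff_gt mult_pos_pos)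
  then have "sqrt (a\<^sup>2 * (3 - 2*a)) < sqrt (b\<^sup>2 * (3 - 2*b))" by simp
  then have "a * sqrt (3 - 2*a) < b * sqrt (3 - 2*b)"
    using assms by (simp add: real_sqrt_mult)
  moreover have "0 \<le> a * sqrt (3 - 2*a)" using assms by simp
  moreover have "R_poly a \<le> R_poly b" "0 < R_poly a"
    using R_poly_mono[of a b] R_poly_ge_one[of a] assms by auto
  ultimately have "a * sqrt (3 - 2*a) * R_poly a < b * sqrt (3 - 2*b) * R_poly b"
    by (metis mult_less_le_imp_less)
  then have "pi * (a * sqrt (3 - 2*a) * R_poly a) < pi * (b * sqrt (3 - 2*b) * R_poly b)"
    by simp
  then show ?thesis by (simp add: threshold_fun_def mult.assoc)
qed

lemma p1_root: "0 < p1" "p1 < 1" "threshold_fun p1 = 4"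
proof -
  have "continuous_on {0..1} threshold_fun"
    unfolding threshold_fun_def[abs_def] R_poly_def[abs_def] by (intro continuous_intros)
  moreover have lo: "threshold_fun 0 = 0" by (simp add: threshold_fun_def)
  \<comment> \<open>\<open>R_poly 1 = 89/64\<close>, so \<open>pi > 3\<close> is precise
    enough.\<close>
  moreover have hi: "threshold_fun 1 > 4" 
    using pi_gt3 by (simp add: threshold_fun_def R_poly_def)
  ultimately obtain r where r: "0 \<le> r" "r \<le> 1" "threshold_fun r = 4"
    using IVT'[of threshold_fun 0 4 1] by auto
  moreover from this have "r \<noteq> 0" "r \<noteq> 1" using lo hi by force+
  ultimately have r': "0 < r" "r < 1" by auto
  have uniq: "s = r" if "0 < s \<and> s < 1 \<and> pi * s * sqrt (3 - 2 * s) * R_poly s = 4" for s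
  proof (cases s r rule: linorder_cases)
    case less
    then show ?thesis using threshold_fun_strict_mono[of s r] that r by (simp add: threshold_fun_def)
  next
    case greater
    then show ?thesis using threshold_fun_strict_mono[of r s] that r by (simp add: threshold_fun_def)
  qed
  have "p1 = r"
    unfolding p1_def
    by (rule the_equality[OF _ uniq]) (use r r' in \<open>simp_all add: threshold_fun_def\<close>)
  with r' r show "0 < p1" "p1 < 1" "threshold_fun p1 = 4" by simp_all
qed

section \<open>Transition operators\<close>

lemma unit_steps_cases:
  assumes "d \<in> unit_steps"
  obtains "d = (1,0)" | "d = (-1,0)" | "d = (0,1)" | "d = (0,-1)"
  using assms by (auto simp: unit_steps_def)

lemma sum_unit_steps:
  "(\<Sum>d\<in>unit_steps. f d) = f (1,0) + f (-1,0) + f (0,1) + f (0,-1)"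
  for f :: "pt \<Rightarrow> 'b::comm_monoid_add"
  by (simp add: unit_steps_def add.assoc)

lemma finite_unit_steps [simp]: "finite unit_steps" and card_unit_steps [simp]: "card unit_steps = 4"
  by (simp_all add: unit_steps_def)

text \<open>Values lie in a real vector space, so that the same operator acts on real probabilities
  and on complex characters.\<close>

definition srw_avg :: "(pt \<Rightarrow> 'b::real_vector) \<Rightarrow> pt \<Rightarrow> 'b" where
  "srw_avg g y = (1/4) *\<^sub>R (\<Sum>d\<in>unit_steps. g (y + d))"

lemma srw_avg_const [simp]: "srw_avg (\<lambda>_. c) y = c"
  by (simp add: srw_avg_def sum_constant_scaleR)

lemma srw_avg_add: "srw_avg (\<lambda>z. f z + g z) y = srw_avg f y + srw_avg g y"
  by (simp add: srw_avg_def sum.distrib scaleR_add_right)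

lemma srw_avg_scaleR: "srw_avg (\<lambda>z. c *\<^sub>R g z) y = c *\<^sub>R srw_avg g y"
  by (simp add: srw_avg_def scaleR_sum_right mult.commute)

lemma srw_avg_cmult: "srw_avg (\<lambda>z. c * g z) y = c * srw_avg g y" for g :: "pt \<Rightarrow> real"
  using srw_avg_scaleR[of c g y] by simp

lemma srw_avg_shift: "srw_avg (\<lambda>z. g (z + c)) y = srw_avg g (y + c)"
  by (simp add: srw_avg_def ac_simps)

lemma srw_avg_mono:
  "(\<And>d. d \<in> unit_steps \<Longrightarrow> f (y + d) \<le> g (y + d)) \<Longrightarrow> srw_avg f y \<le> srw_avg g y"
  for f g :: "pt \<Rightarrow> real"
  unfolding srw_avg_def by (intro scaleR_left_mono sum_mono) auto

section \<open>Few-step hitting probabilities of the simple random walk\<close>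

definition point_mass :: "pt \<Rightarrow> pt \<Rightarrow> real" where
  "point_mass h z = (if z = h then 1 else 0)"

lemma srw_avg_Pair:
  "srw_avg g (a, b) = (g (a + 1, b) + g (a - 1, b) + g (a, b + 1) + g (a, b - 1)) / 4"
  for g :: "pt \<Rightarrow> real"
  by (simp add: srw_avg_def sum_unit_steps)

text \<open>Moving \<open>h\<close> to the origin leaves concrete coordinates, on which the iterated
  averages below can be evaluated by simplification.\<close>

lemma point_mass_shift: "point_mass h = (\<lambda>z. point_mass (0,0) (z + - h))"
  by (auto simp: point_mass_def fun_eq_iff prod_eq_iff)

lemma srw_avg_shift': "srw_avg (\<lambda>z. g (z + c)) = (\<lambda>y. srw_avg g (y + c))"
  by (rule ext) (rule srw_avg_shift)

lemma srw_return_2: "srw_avg (srw_avg (point_mass h)) h = 1/4"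
  unfolding point_mass_shift[of h] srw_avg_shift'
  by (simp add: zero_prod_def srw_avg_Pair point_mass_def)

text \<open>Undoing the two steps is one of 16 equally likely paths, and for \<open>d = e\<close> it
  is the only one that works.\<close>

lemma srw_reach_2:
  assumes "d \<in> unit_steps" "e \<in> unit_steps"
  shows "1/16 \<le> srw_avg (srw_avg (point_mass h)) (h + d + e)"
proof -
  have "h + d + e + - h = d + e" by simp
  with assms show ?thesis
    unfolding point_mass_shift[of h] srw_avg_shift'
    by (elim unit_steps_cases) (simp_all add: srw_avg_Pair point_mass_def)
qed

lemma srw_reach_1:
  assumes "d \<in> unit_steps"
  shows "srw_avg (point_mass h) (h + d) = 1/4"
proof -
  have "h + d + - h = d" by simp
  with assms show ?thesis
    unfolding point_mass_shift[of h] srw_avg_shift'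
    by (elim unit_steps_cases) (simp_all add: srw_avg_Pair point_mass_def)
qed

lemma srw_reach_3:
  assumes "d \<in> unit_steps"
  shows "srw_avg (srw_avg (srw_avg (point_mass h))) (h + d) = 9/64"
proof -
  have "h + d + - h = d" by simp
  with assms show ?thesis
    unfolding point_mass_shift[of h] srw_avg_shift'
    by (elim unit_steps_cases) (simp_all add: srw_avg_Pair point_mass_def)
qed

lemma srw_return_4: "srw_avg (srw_avg (srw_avg (srw_avg (point_mass h)))) h = 9/64"
proof -
  have "srw_avg (srw_avg (srw_avg (srw_avg (point_mass h)))) h
      = (1/4) *\<^sub>R (\<Sum>d\<in>unit_steps. 9/64)"
    unfolding srw_avg_def[of _ h] by (intro arg_cong2[of _ _ _ _ scaleR] sum.cong refl srw_reach_3)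
  then show ?thesis by simp
qed

section \<open>One-step, free and killed operators of the guided walk\<close>

locale guided_walk =
  fixes p :: real and s :: "nat \<Rightarrow> pt"
  assumes p_nonneg: "0 \<le> p" and p_le_1: "p \<le> 1" and s_unit: "\<And>t. s t \<in> unit_steps"
begin

definition step :: "nat \<Rightarrow> (pt \<Rightarrow> 'b::real_vector) \<Rightarrow> pt \<Rightarrow> 'b" where
  "step t g y = p *\<^sub>R srw_avg g y + (1 - p) *\<^sub>R g (y + s t)"

lemma step_const [simp]: "step t (\<lambda>_. c) y = c"
  by (simp add: step_def scaleR_left_distrib[symmetric])

lemma step_add: "step t (\<lambda>z. f z + g z) y = step t f y + step t g y"
  by (simp add: step_def srw_avg_add scaleR_add_right)

lemma step_scaleR: "step t (\<lambda>z. c *\<^sub>R g z) y = c *\<^sub>R step t g y"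
  by (simp add: step_def srw_avg_scaleR scaleR_add_right mult.commute)

lemma step_mono:
  "(\<And>d. d \<in> unit_steps \<Longrightarrow> f (y + d) \<le> g (y + d)) \<Longrightarrow> step t f y \<le> step t g y"
  for f g :: "pt \<Rightarrow> real"
  unfolding step_def
  using p_nonneg p_le_1 s_unit[of t] by (intro add_mono scaleR_left_mono srw_avg_mono) auto

lemma step_nonneg:
  "(\<And>d. d \<in> unit_steps \<Longrightarrow> 0 \<le> g (y + d)) \<Longrightarrow> 0 \<le> step t g y" for g :: "pt \<Rightarrow> real"
  using step_mono[of "\<lambda>_. 0" y g t] by simp

lemma step_cong:
  "(\<And>d. d \<in> unit_steps \<Longrightarrow> f (y + d) = g (y + d)) \<Longrightarrow> step t f y = step t g y"
  unfolding step_def srw_avg_def using s_unit[of t] by simp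

text \<open>Expectations of functions of the position after \<open>n\<close> steps, for the walk started in a given
  point at time \<open>t\<close>: \<open>free\<close> for the walk itself, \<open>kill\<close> restricted to the event that \<open>h\<close> is not
  visited at the times \<open>t + 1, \<dots>, t + n\<close>.\<close>

primrec free :: "nat \<Rightarrow> nat \<Rightarrow> (pt \<Rightarrow> 'b::real_vector) \<Rightarrow> pt \<Rightarrow> 'b" where
  "free t 0 g = g"
| "free t (Suc n) g = step t (free (Suc t) n g)"

primrec kill :: "pt \<Rightarrow> nat \<Rightarrow> nat \<Rightarrow> (pt \<Rightarrow> 'b::real_vector) \<Rightarrow> pt \<Rightarrow> 'b" where
  "kill h t 0 g = g"
| "kill h t (Suc n) g = step t (\<lambda>z. if z = h then 0 else kill h (Suc t) n g z)"
  for h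

lemma kill_add: "kill h t (n + m) g = kill h t n (kill h (t + n) m g)"
  by (induction n arbitrary: t) (simp_all cong: if_cong)

text \<open>The recursion peels off the first step. Exposing the last step instead suits arguments
  that move forward in time.\<close>

lemma kill_Suc': "kill h t (Suc n) g = kill h t n (step (t + n) (\<lambda>z. if z = h then 0 else g z))"
  using kill_add[of h t n 1 g] by (simp cong: if_cong)

lemma kill_mono:
  fixes f g :: "pt \<Rightarrow> real"
  assumes "\<And>z. z \<noteq> h \<Longrightarrow> f z \<le> g z" "y \<noteq> h"
  shows "kill h t n f y \<le> kill h t n g y"
  using assms(2)
proof (induction n arbitrary: t y)
  case (Suc n)
  show ?case
    unfolding kill.simps by (rule step_mono) (simp add: Suc.IH)
qed (use assms in simp)

lemma kill_linear:
  "kill h t n (\<lambda>z. f z + c *\<^sub>R g z) y = kill h t n f y + c *\<^sub>R kill h t n g y"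
proof (induction n arbitrary: t y)
  case (Suc n)
  have "kill h t (Suc n) (\<lambda>z. f z + c *\<^sub>R g z) y
      = step t (\<lambda>z. (if z = h then 0 else kill h (Suc t) n f z)
                + c *\<^sub>R (if z = h then 0 else kill h (Suc t) n g z)) y"
    by (auto simp: Suc.IH intro!: step_cong)
  then show ?case by (simp add: step_add step_scaleR)
qed simp

lemma kill_zero: "kill h t n (\<lambda>_. 0) y = 0"
  using kill_linear[of h t n "\<lambda>_. 0" 1 "\<lambda>_. 0" y] by simp

lemma kill_scaleR: "kill h t n (\<lambda>z. c *\<^sub>R g z) y = c *\<^sub>R kill h t n g y"
  using kill_linear[of h t n "\<lambda>_. 0" c g y] by (simp add: kill_zero)

lemma kill_cmult: "kill h t n (\<lambda>z. c * g z) y = c * kill h t n g y" for g :: "pt \<Rightarrow> real"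
  using kill_scaleR[of h t n c g y] by simp

lemma kill_nonneg:
  fixes g :: "pt \<Rightarrow> real"
  assumes "\<And>z. z \<noteq> h \<Longrightarrow> 0 \<le> g z" "y \<noteq> h"
  shows "0 \<le> kill h t n g y"
  using kill_mono[of h "\<lambda>_. 0" g y t n] assms by (simp add: kill_zero)

lemma free_nonneg: "(\<And>z. 0 \<le> g z) \<Longrightarrow> 0 \<le> free t n g y" for g :: "pt \<Rightarrow> real"
  by (induction n arbitrary: t y) (auto intro: step_nonneg)

abbreviation surv :: "pt \<Rightarrow> nat \<Rightarrow> nat \<Rightarrow> pt \<Rightarrow> real" where
  "surv h t n \<equiv> kill h t n (\<lambda>_. 1)"

lemma surv_nonneg: "y \<noteq> h \<Longrightarrow> 0 \<le> surv h t n y"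
  by (rule kill_nonneg) auto

lemma surv_le_1: "surv h t n y \<le> 1"
proof (induction n arbitrary: t y)
  case (Suc n)
  have "surv h t (Suc n) y \<le> step t (\<lambda>_. 1) y"
    unfolding kill.simps by (rule step_mono) (simp add: Suc.IH)
  then show ?case by simp
qed simp

subsection \<open>First passage\<close>

text \<open>\<open>first h m\<close> is the probability that the walk from the origin hits \<open>h\<close> for the first time
  at time \<open>m + 1\<close>.\<close>

definition first :: "pt \<Rightarrow> nat \<Rightarrow> real" where
  "first h m = kill h 0 m (step m (point_mass h)) 0"

text \<open>An unrestricted step is split according to whether it lands on \<open>h\<close>; for
  paths that have avoided \<open>h\<close> so far, landing there is the event measured by
  \<open>first h m\<close>.\<close>

lemma kill_step:
  fixes g :: "pt \<Rightarrow> real"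
  shows "kill h 0 m (step m g) 0 = kill h 0 (Suc m) g 0 + first h m * g h"
proof -
  have "step m g = (\<lambda>y. step m (\<lambda>z. if z = h then 0 else g z) y + g h *\<^sub>R step m (point_mass h) y)"
    unfolding step_scaleR[symmetric] step_add[symmetric]
    by (rule ext, rule step_cong) (auto simp: point_mass_def)
  then have "kill h 0 m (step m g) 0 = kill h 0 m (\<lambda>y. step m (\<lambda>z. if z = h then 0 else g z) y
      + g h *\<^sub>R step m (point_mass h) y) 0" by simp
  also have "\<dots> = kill h 0 (Suc m) g 0 + first h m * g h"
    unfolding kill_linear kill_Suc' by (simp add: first_def mult.commute)
  finally show ?thesis .
qed

lemma surv_diff: "surv h 0 m 0 - surv h 0 (Suc m) 0 = first h m"
proof -
  have *: "step m (\<lambda>_::pt. 1::real) = (\<lambda>_. 1)" by (rule ext) simp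
  show ?thesis using kill_step[of h m "\<lambda>_. 1"] unfolding * by simp
qed

lemma first_nonneg: "h \<noteq> 0 \<Longrightarrow> 0 \<le> first h m"
  unfolding first_def by (intro kill_nonneg step_nonneg) (auto simp: point_mass_def)

lemma surv_antimono: "h \<noteq> 0 \<Longrightarrow> m \<le> n \<Longrightarrow> surv h 0 n 0 \<le> surv h 0 m 0"
  by (rule lift_Suc_antimono_le) (use surv_diff first_nonneg in \<open>auto simp: algebra_simps\<close>)

text \<open>Paths that avoid \<open>h\<close> up to time \<open>m\<close> and are at
  \<open>h\<close> at time \<open>m + k\<close> are classified by their first visit, at time
  \<open>m + i + 1\<close>; they must then return in the remaining \<open>k - 1 - i\<close> steps.
  The induction moves one step at a time from the free to the killed part.\<close>

lemma first_passage:
  assumes "h \<noteq> 0"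
  shows "(\<Sum>i<k. first h (m + i) * free (m + i + 1) (k - 1 - i) (point_mass h) h)
    \<le> kill h 0 m (free m k (point_mass h)) 0"
proof (induction k arbitrary: m)
  case 0
  show ?case using assms by (auto intro!: kill_nonneg simp: point_mass_def)
next
  case (Suc k)
  have "(\<Sum>i<Suc k. first h (m + i) * free (m + i + 1) (Suc k - 1 - i) (point_mass h) h)
      = first h m * free (Suc m) k (point_mass h) h
      + (\<Sum>i<k. first h (Suc m + i) * free (Suc m + i + 1) (k - 1 - i) (point_mass h) h)"
    unfolding sum.lessThan_Suc_shift by simp
  also have "\<dots> \<le> first h m * free (Suc m) k (point_mass h) h
      + kill h 0 (Suc m) (free (Suc m) k (point_mass h)) 0"
    using Suc.IH[of "Suc m"] by simp
  also have "\<dots> = kill h 0 m (free m (Suc k) (point_mass h)) 0"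
    by (simp add: kill_step)
  finally show ?case .
qed

lemma kill_free_le:
  assumes "h \<noteq> 0" "\<And>z. free m k (point_mass h) z \<le> C"
  shows "kill h 0 m (free m k (point_mass h)) 0 \<le> surv h 0 m 0 * C"
proof -
  have "kill h 0 m (free m k (point_mass h)) 0 \<le> kill h 0 m (\<lambda>_. C * 1) 0"
    using assms by (intro kill_mono) auto
  then show ?thesis unfolding kill_cmult by (simp add: mult.commute)
qed

section \<open>Return probabilities after two and four steps\<close>

text \<open>Split by which steps are random. Two random steps return with probability 1/4; a single
  random step undoes the instructed one with probability 1/4, in either order. Two instructed steps
  may contribute nothing and are dropped.\<close>

lemma free_return_2:
  "1/4 * p^2 + 1/2 * p * (1 - p) \<le> free t 2 (point_mass h) h"
proof -
  let ?U = srw_avg and ?g = "point_mass h"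
  define q where "q = 1 - p"
  have st: "step t' g y = p * ?U g y + q * g (y + s t')" for t' y and g :: "pt \<Rightarrow> real"
    by (simp add: step_def q_def)
  have "free t 2 ?g h = p^2 * ?U (?U ?g) h
      + p * q * (?U ?g (h + s t) + ?U ?g (h + s (Suc t))) + q^2 * ?g (h + s t + s (Suc t))"
    by (simp add: numeral_2_eq_2 st[abs_def] srw_avg_add srw_avg_cmult srw_avg_shift
        algebra_simps)
  moreover have "0 \<le> q^2 * ?g (h + s t + s (Suc t))" by (simp add: point_mass_def)
  ultimately show ?thesis
    by (simp add: srw_return_2 srw_reach_1 s_unit q_def)
qed

text \<open>Averaging commutes with translations, so only the instructed steps matter, not their
  order. With four, three or two random steps the return probability is 9/64, 9/64 or at least 1/16,
  and there are 1, 4 and 6 such patterns. The remaining patterns are dropped.\<close>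

lemma free_return_4:
  "9/64 * p^4 + 9/16 * p^3 * (1 - p) + 3/8 * p^2 * (1 - p)^2 \<le> free t 4 (point_mass h) h"
proof -
  let ?g = "point_mass h"
  define U where "U = (srw_avg :: (pt \<Rightarrow> real) \<Rightarrow> pt \<Rightarrow> real)"
  define q where "q = 1 - p"
  define a b c d where "a = s t" and "b = s (t + 1)" and "c = s (t + 2)" and "d = s (t + 3)"
  have abcd: "a \<in> unit_steps" "b \<in> unit_steps" "c \<in> unit_steps" "d \<in> unit_steps"
    by (simp_all add: a_def b_def c_def d_def s_unit)
  have pq: "0 \<le> p" "0 \<le> q" using p_nonneg p_le_1 by (auto simp: q_def)
  have st: "step t' g y = p * U g y + q * g (y + s t')" for t' y and g :: "pt \<Rightarrow> real"
    by (simp add: step_def U_def q_def)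
  have lin: "U (\<lambda>z. f z + g z) y = U f y + U g y" "U (\<lambda>z. k * g z) y = k * U g y"
    "U (\<lambda>z. g (z + e)) y = U g (y + e)" for f g y k e
    by (simp_all add: U_def srw_avg_add srw_avg_cmult srw_avg_shift)
  have Unn: "0 \<le> U g y" if "\<And>z. 0 \<le> g z" for g y
    using srw_avg_mono[of "\<lambda>_. 0" y g] that by (simp add: U_def)
  have g0: "0 \<le> ?g z" for z by (simp add: point_mass_def)
  have "free t 4 ?g h = p^4 * U (U (U (U ?g))) h
    + p^3 * q * (U (U (U ?g)) (h + a) + U (U (U ?g)) (h + b) + U (U (U ?g)) (h + c) + U (U (U ?g)) (h + d))
    + p^2 * q^2 * (U (U ?g) (h + a + b) + U (U ?g) (h + a + c) + U (U ?g) (h + a + d)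
       + U (U ?g) (h + b + c) + U (U ?g) (h + b + d) + U (U ?g) (h + c + d))
    + p * q^3 * (U ?g (h + a + b + c) + U ?g (h + a + b + d) + U ?g (h + a + c + d) + U ?g (h + b + c + d))
    + q^4 * ?g (h + a + b + c + d)"
    by (simp add: eval_nat_numeral st[abs_def] lin a_def b_def c_def d_def algebra_simps)
  moreover have "0 \<le> p * q^3 * (U ?g (h + a + b + c) + U ?g (h + a + b + d) + U ?g (h + a + c + d) + U ?g (h + b + c + d))
    + q^4 * ?g (h + a + b + c + d)"
    using pq by (intro add_nonneg_nonneg mult_nonneg_nonneg Unn g0) auto
  moreover have "p^2 * q^2 * (U (U ?g) (h + a + b) + U (U ?g) (h + a + c) + U (U ?g) (h + a + d)
       + U (U ?g) (h + b + c) + U (U ?g) (h + b + d) + U (U ?g) (h + c + d))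
    \<ge> p^2 * q^2 * (1/16 + 1/16 + 1/16 + 1/16 + 1/16 + 1/16)"
    unfolding U_def using abcd by (intro mult_left_mono add_mono srw_reach_2) auto
  ultimately show ?thesis
    using abcd unfolding U_def by (simp add: srw_return_4 srw_reach_3 q_def)
qed

subsection \<open>Parity\<close>

text \<open>Every step changes the parity of the coordinate sum.\<close>

lemma kill_parity:
  assumes "\<And>z. even (fst z + snd z) \<noteq> even (fst y + snd y + int n) \<or> g z = 0"
  shows "kill h t n g y = 0"
  using assms
proof (induction n arbitrary: t y)
  case (Suc n)
  have "kill h t (Suc n) g y = step t (\<lambda>_. 0) y"
    unfolding kill.simps
  proof (rule step_cong)
    fix d assume "d \<in> unit_steps"
    then have "even (fst (y + d) + snd (y + d) + int n) = even (fst y + snd y + int (Suc n))"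
      by (elim unit_steps_cases) auto
    then show "(if y + d = h then 0 else kill h (Suc t) n g (y + d)) = 0"
      using Suc.IH[of "y + d" "Suc t"] Suc.prems by auto
  qed
  then show ?case by simp
next
  case 0
  then show ?case by fastforce
qed

lemma first_parity:
  assumes "even (fst h + snd h) \<noteq> even (Suc m)"
  shows "first h m = 0"
  unfolding first_def
proof (rule kill_parity)
  fix z :: pt
  show "even (fst z + snd z) \<noteq> even (fst (0::pt) + snd (0::pt) + int m)
      \<or> step m (point_mass h) z = 0"
  proof (cases "even (fst z + snd z) = even (int m)")
    case True
    have "step m (point_mass h) z = step m (\<lambda>_. 0) z"
    proof (rule step_cong)
      fix d assume "d \<in> unit_steps"
      then have "even (fst (z + d) + snd (z + d)) \<noteq> even (fst z + snd z)"
        by (elim unit_steps_cases) auto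
      then have "z + d \<noteq> h" using True assms by auto
      then show "point_mass h (z + d) = 0" by (simp add: point_mass_def)
    qed
    then show ?thesis by simp
  qed auto
qed

subsection \<open>Subexponential survival\<close>

text \<open>A prescribed direction is taken by a random step with probability \<open>p/4\<close>;
  all other outcomes are discarded.\<close>

lemma surv_force:
  assumes "x \<noteq> h" "d \<in> unit_steps" "x + d \<noteq> h"
  shows "p/4 * surv h (Suc t) n (x + d) \<le> surv h t (Suc n) x"
proof -
  let ?g = "\<lambda>z. if z = h then 0 else surv h (Suc t) n z"
  have g: "0 \<le> ?g z" for z by (auto intro: surv_nonneg)
  have "?g (x + d) \<le> (\<Sum>d\<in>unit_steps. ?g (x + d))"
    by (rule member_le_sum) (use assms g in auto)
  then have "p/4 * ?g (x + d) \<le> p * srw_avg ?g x"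
    using p_nonneg by (auto simp: srw_avg_def intro!: mult_left_mono)
  also have "\<dots> \<le> step t ?g x"
    using p_le_1 g[of "x + s t"] unfolding step_def by simp
  finally show ?thesis using assms by simp
qed

lemma surv_force_line:
  assumes "d \<in> unit_steps" "\<And>i. i \<le> k \<Longrightarrow> x + (int i * fst d, int i * snd d) \<noteq> h"
  shows "(p/4)^k * surv h (t + k) n (x + (int k * fst d, int k * snd d)) \<le> surv h t (k + n) x"
  using assms(2)
proof (induction k arbitrary: x t)
  case 0
  then show ?case by (simp flip: zero_prod_def)
next
  case (Suc k)
  have eq: "x + d + (int i * fst d, int i * snd d) = x + (int (Suc i) * fst d, int (Suc i) * snd d)" for i
    by (cases d, cases x) (simp add: algebra_simps)
  have x: "x \<noteq> h" using Suc.prems[of 0] by (simp flip: zero_prod_def)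
  have xd: "x + d \<noteq> h" using Suc.prems[of 1] by simp
  have "(p/4)^k * surv h (Suc t + k) n (x + d + (int k * fst d, int k * snd d)) \<le> surv h (Suc t) (k + n) (x + d)"
    by (rule Suc.IH) (use Suc.prems in \<open>simp only: eq\<close>; simp)
  then have "p/4 * ((p/4)^k * surv h (Suc t + k) n (x + d + (int k * fst d, int k * snd d)))
      \<le> p/4 * surv h (Suc t) (k + n) (x + d)"
    using p_nonneg by (intro mult_left_mono) auto
  also have "\<dots> \<le> surv h t (Suc (k + n)) x" by (rule surv_force[OF x assms(1) xd])
  finally show ?case unfolding eq by (simp add: mult.assoc)
qed

lemma surv_force_wait:
  assumes "d \<in> unit_steps" "x \<noteq> h" "x + d \<noteq> h"
  shows "(p/4)^(2*k) * surv h (t + 2*k) n x \<le> surv h t (2*k + n) x"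
proof (induction k arbitrary: t)
  case (Suc k)
  have md: "- d \<in> unit_steps" using assms(1) by (auto simp: unit_steps_def)
  have "(p/4)^(2*k) * surv h (t + 2 + 2*k) n x \<le> surv h (t + 2) (2*k + n) x"
    by (rule Suc.IH)
  then have "(p/4)^2 * ((p/4)^(2*k) * surv h (t + 2 + 2*k) n x) \<le> (p/4)^2 * surv h (t + 2) (2*k + n) x"
    by (intro mult_left_mono) auto
  also have "\<dots> = p/4 * (p/4 * surv h (Suc (Suc t)) (2*k + n) (x + d + - d))"
    by (simp add: power2_eq_square)
  also have "\<dots> \<le> p/4 * surv h (Suc t) (Suc (2*k + n)) (x + d)"
    using p_nonneg assms by (intro mult_left_mono surv_force md) auto
  also have "\<dots> \<le> surv h t (Suc (Suc (2*k + n))) x"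
    by (rule surv_force) (use assms in auto)
  finally show ?case by (simp add: power2_eq_square mult_ac)
qed simp

text \<open>The law of the increments does not depend on the position. Hence for each of the
  \<open>n\<close> times, the probabilities of being at \<open>h\<close>, summed over distinct
  starting points, are at most 1 in total. \<open>Y\<close> is arbitrary because the induction
  passes to translates of it.\<close>

lemma sum_hit_le:
  assumes "finite Y"
  shows "(\<Sum>y\<in>Y. 1 - surv h t n y) \<le> real n"
  using assms
proof (induction n arbitrary: t Y)
  case (Suc n)
  let ?g = "\<lambda>z. 1 - (if z = h then 0 else surv h (Suc t) n z)"
  have g: "(\<Sum>y\<in>Y. ?g (y + d)) \<le> real (Suc n)" for d
  proof -
    have "(\<Sum>y\<in>Y. ?g (y + d)) = (\<Sum>y\<in>(\<lambda>y. y + d) ` Y. ?g y)"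
      by (subst sum.reindex) (auto simp: inj_on_def)
    also have "\<dots> \<le> (\<Sum>y\<in>(\<lambda>y. y + d) ` Y. point_mass h y + (1 - surv h (Suc t) n y))"
      by (intro sum_mono) (auto simp: point_mass_def surv_le_1)
    also have "\<dots> = (\<Sum>y\<in>(\<lambda>y. y + d) ` Y. point_mass h y)
        + (\<Sum>y\<in>(\<lambda>y. y + d) ` Y. 1 - surv h (Suc t) n y)"
      by (rule sum.distrib)
    also have "\<dots> \<le> 1 + real n"
      using Suc.prems by (intro add_mono Suc.IH) (auto simp: point_mass_def)
    finally show ?thesis by simp
  qed
  have *: "1 - surv h t (Suc n) y = step t ?g y" for y
    using step_add[of t ?g "\<lambda>z. if z = h then 0 else surv h (Suc t) n z" y] by simp
  have "(\<Sum>y\<in>Y. 1 - surv h t (Suc n) y) = p/4 * (\<Sum>d\<in>unit_steps. \<Sum>y\<in>Y. ?g (y + d))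
      + (1 - p) * (\<Sum>y\<in>Y. ?g (y + s t))"
    unfolding * step_def srw_avg_def sum.distrib sum.swap[of _ Y unit_steps]
    by (simp add: sum_distrib_left mult.assoc)
  also have "\<dots> \<le> p/4 * (\<Sum>d\<in>unit_steps. real (Suc n)) + (1 - p) * real (Suc n)"
    using p_nonneg p_le_1 by (intro add_mono mult_left_mono sum_mono g) auto
  also have "\<dots> = real (Suc n)" by (simp add: algebra_simps)
  finally show ?case .
qed simp

lemma surv_block:
  assumes "x \<noteq> h" "2 * n \<le> (r + 1)^2"
  shows "(p/4)^(4*r) / 2 \<le> surv h t (4*r + n) x"
proof -
  text \<open>Moving in the directions \<open>d1\<close> and \<open>d2\<close> leads away from \<open>h\<close>. Waiting by going back and
    forth makes all endpoints with even coordinates reachable at the same time.\<close>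
  define e1 e2 :: int where "e1 = (if fst x \<ge> fst h then 1 else -1)"
    and "e2 = (if snd x \<ge> snd h then 1 else -1)"
  define d1 d2 :: pt where "d1 = (e1, 0)" and "d2 = (0, e2)"
  have d: "d1 \<in> unit_steps" "d2 \<in> unit_steps"
    by (auto simp: d1_def d2_def e1_def e2_def unit_steps_def)
  have away: "x + (int i * e1, int j * e2) \<noteq> h" for i j
  proof
    assume "x + (int i * e1, int j * e2) = h"
    then have "fst x + int i * e1 = fst h" "snd x + int j * e2 = snd h" by auto
    then have "fst x = fst h" "snd x = snd h"
      by (auto simp: e1_def e2_def split: if_splits)
    with assms(1) show False by (simp add: prod_eq_iff)
  qed
  define y where "y i j = x + (int (2*i) * e1, int (2*j) * e2)" for i j :: nat
  define Y where "Y = (\<lambda>(i,j). y i j) ` ({..r} \<times> {..r})"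
  have "inj_on (\<lambda>(i,j). y i j) ({..r} \<times> {..r})"
    by (auto simp: inj_on_def y_def e1_def e2_def split: if_splits)
  then have cardY: "card Y = (r + 1)^2"
    by (simp add: Y_def card_image power2_eq_square)
  \<comment> \<open>Otherwise the hitting probabilities would add up to more than half the size of
    \<open>Y\<close>, which is at least \<open>n\<close>, against \<open>sum_hit_le\<close>.\<close>
  have "\<exists>z\<in>Y. 1/2 \<le> surv h (t + 4*r) n z"
  proof (rule ccontr)
    assume "\<not> ?thesis"
    then have "\<And>z. z \<in> Y \<Longrightarrow> 1/2 < 1 - surv h (t + 4*r) n z" by force
    then have "(\<Sum>z\<in>Y. 1/2) < (\<Sum>z\<in>Y. 1 - surv h (t + 4*r) n z)"
      by (intro sum_strict_mono) (auto simp: Y_def)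
    also have "\<dots> \<le> real n" by (rule sum_hit_le) (simp add: Y_def)
    finally have "real (card Y) < 2 * real n" by simp
    with assms(2) cardY show False by linarith
  qed
  then obtain i j where ij: "i \<le> r" "j \<le> r" and z: "1/2 \<le> surv h (t + 4*r) n (y i j)"
    by (auto simp: Y_def)
  define k where "k = 2 * r - i - j"
  have k: "2 * k + (2 * i + 2 * j) = 4 * r" using ij by (simp add: k_def)
  have "(p/4)^(2*j) * surv h (t + 2*k + 2*i + 2*j) n (x + (int (2*i) * fst d1, int (2*i) * snd d1) + (int (2*j) * fst d2, int (2*j) * snd d2))
     \<le> surv h (t + 2*k + 2*i) (2*j + n) (x + (int (2*i) * fst d1, int (2*i) * snd d1))"
    by (rule surv_force_line[OF d(2)]) (use away[of "2*i"] in \<open>simp add: d1_def d2_def add.assoc\<close>)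
  moreover have "y i j = x + (int (2*i) * fst d1, int (2*i) * snd d1) + (int (2*j) * fst d2, int (2*j) * snd d2)"
    by (cases x) (simp add: y_def d1_def d2_def)
  moreover have "t + 2*k + 2*i + 2*j = t + 4*r" using k by simp
  ultimately have 1: "(p/4)^(2*j) * surv h (t + 4*r) n (y i j) \<le> surv h (t + 2*k + 2*i) (2*j + n) (x + (int (2*i) * fst d1, int (2*i) * snd d1))"
    by (simp only:)
  have 2: "(p/4)^(2*i) * surv h (t + 2*k + 2*i) (2*j + n) (x + (int (2*i) * fst d1, int (2*i) * snd d1))
     \<le> surv h (t + 2*k) (2*i + (2*j + n)) x"
    by (rule surv_force_line[OF d(1)]) (use away[of _ 0] in \<open>simp add: d1_def\<close>)
  have "2*k + (2*i + (2*j + n)) = 4*r + n" using k by simp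
  moreover have "(p/4)^(2*k) * surv h (t + 2*k) (2*i + (2*j + n)) x \<le> surv h t (2*k + (2*i + (2*j + n))) x"
    by (rule surv_force_wait[OF d(1) assms(1)]) (use away[of 1 0] in \<open>simp add: d1_def\<close>)
  ultimately have 3: "(p/4)^(2*k) * surv h (t + 2*k) (2*i + (2*j + n)) x \<le> surv h t (4*r + n) x"
    by (simp only:)
  have "(p/4)^(4*r) / 2 = (p/4)^(2*k) * ((p/4)^(2*i) * ((p/4)^(2*j) * (1/2)))"
    unfolding k[symmetric] power_add by simp
  also have "\<dots> \<le> (p/4)^(2*k) * ((p/4)^(2*i) * ((p/4)^(2*j) * surv h (t + 4*r) n (y i j)))"
    using p_nonneg by (intro mult_left_mono z) auto
  also have "\<dots> \<le> (p/4)^(2*k) * ((p/4)^(2*i) * surv h (t + 2*k + 2*i) (2*j + n) (x + (int (2*i) * fst d1, int (2*i) * snd d1)))"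
    using p_nonneg by (intro mult_left_mono 1) auto
  also have "\<dots> \<le> (p/4)^(2*k) * surv h (t + 2*k) (2*i + (2*j + n)) x"
    using p_nonneg by (intro mult_left_mono 2) auto
  also have "\<dots> \<le> surv h t (4*r + n) x" by (rule 3)
  finally show ?thesis .
qed

text \<open>The bound of \<open>surv_block\<close> is uniform in the starting time and point, so it
  can be iterated by the Markov property.\<close>

lemma surv_geometric:
  assumes "h \<noteq> 0" "2 * n \<le> (r + 1)^2"
  shows "((p/4)^(4*r) / 2)^j \<le> surv h 0 (j * (4*r + n)) 0"
proof (induction j)
  case (Suc j)
  let ?N = "4*r + n" and ?e = "(p/4)^(4*r) / 2"
  have "?e ^ Suc j \<le> ?e * surv h 0 (j * ?N) 0"
    using Suc p_nonneg by (simp add: mult_left_mono)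
  also have "\<dots> = kill h 0 (j * ?N) (\<lambda>_. ?e * 1) 0" by (simp only: kill_cmult)
  also have "\<dots> \<le> kill h 0 (j * ?N) (surv h (0 + j * ?N) ?N) 0"
    using assms surv_block[of _ h n r] by (intro kill_mono) auto
  also have "\<dots> = surv h 0 (j * ?N + ?N) 0" by (simp only: kill_add)
  finally show ?case by (simp only: mult_Suc add.commute)
qed simp

text \<open>A block has length of order \<open>i\<^sup>2\<close> but costs only a factor exponential
  in \<open>i\<close>, so for large \<open>i\<close> the gain \<open>q ^ N\<close> wins. Time is
  doubled because survival will be observed along one parity class.\<close>

lemma surv_subexponential:
  assumes "h \<noteq> 0" "0 < p" "1 < q"
  shows "\<exists>n. C < surv h 0 (2 * n + l) 0 * q ^ n"
proof -
  \<comment> \<open>With this \<open>c\<close>, the growth factor \<open>q^N * e^2\<close> equals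
    \<open>((q^2)^i * c)^i / 4\<close>, so a base of at least 5 makes it exceed 1.\<close>
  define c where "c = q^8 * (p/4)^16"
  have c: "c > 0" using assms by (simp add: c_def)
  obtain i0 where i0: "5 / c < (q^2) ^ i0"
    using real_arch_pow[of "q^2" "5 / c"] assms by (auto simp: one_less_power)
  define i where "i = Suc i0"
  define e where "e = (p/4)^(8*i) / 2"
  define N where "N = 8*i + 2*i^2"
  have e: "e > 0" using assms by (simp add: e_def)
  have N: "N \<ge> 1" by (simp add: N_def i_def)
  have "5 / c < (q^2)^i"
    by (rule less_le_trans[OF i0 power_increasing]) (use assms in \<open>auto simp: i_def\<close>)
  then have 5: "5 \<le> (q^2)^i * c" using c by (simp add: field_simps)
  have "5 * 1 \<le> 5 * (5::real)^i0" by (intro mult_left_mono) auto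
  then have "(5::real) \<le> 5^i" by (simp add: i_def)
  also have "\<dots> \<le> ((q^2)^i * c)^i" using 5 by (intro power_mono) auto
  also have "\<dots> = q^N * e^2 * 4"
  proof -
    have "((q^2)^i * (q^8 * w^16))^i = q^(8*i + 2*i^2) * (w^(8*i) / 2)^2 * 4" for w :: real
    proof -
      have "((q^2)^i * (q^8 * w^16))^i = q^(2*i*i) * (q^(8*i) * w^(16*i))"
        unfolding power_mult_distrib power_mult[symmetric] by simp
      moreover have "(w^(8*i) / 2)^2 = w^(16*i) / 4"
        unfolding power_divide power_mult[symmetric] by simp
      ultimately show ?thesis by (simp add: power_add power2_eq_square mult.assoc)
    qed
    then show ?thesis unfolding N_def e_def c_def .
  qed
  finally have gt1: "1 < q^N * e^2" by simp
  obtain j where j: "C / e^l < (q^N * e^2)^j" using real_arch_pow[OF gt1] by blast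
  define n where "n = j * N"
  have "2 * (2*i^2) \<le> (2*i + 1)^2" by (simp add: power2_eq_square algebra_simps)
  \<comment> \<open>As \<open>N\<close> is at least 1, \<open>2*j + l\<close> blocks of length
    \<open>N\<close> cover the time \<open>2 * n + l\<close>.\<close>
  then have "e^(2*j + l) \<le> surv h 0 ((2*j + l) * N) 0"
    using surv_geometric[of h "2*i^2" "2*i" "2*j + l"] assms by (simp add: e_def N_def)
  also have "\<dots> \<le> surv h 0 (2 * n + l) 0"
    using N assms by (intro surv_antimono) (auto simp: n_def algebra_simps)
  finally have *: "e^(2*j + l) \<le> surv h 0 (2 * n + l) 0" .
  have "C < (q^N * e^2)^j * e^l" using j e by (simp add: field_simps)
  also have "\<dots> = e^(2*j + l) * q^n"
    by (simp add: n_def power_mult_distrib power_mult[symmetric] power_add mult_ac)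
  also have "\<dots> \<le> surv h 0 (2 * n + l) 0 * q^n"
    using * assms by (intro mult_right_mono) auto
  finally show ?thesis by blast
qed

end

section \<open>Fourier analysis on the torus\<close>

text \<open>This period has both 0 and \<open>pi\<close> in its interior; the characteristic
  functions concentrate near \<open>(0, 0)\<close> and \<open>(pi, pi)\<close>.\<close>

abbreviation torus_range :: "real set" where
  "torus_range \<equiv> {- (pi/2) .. 3*pi/2}"

definition circle :: "real measure" where
  "circle = density lborel (\<lambda>x. ennreal (indicator torus_range x / (2 * pi)))"

lemma sets_circle [measurable_cong]: "sets circle = sets borel"
  by (simp add: circle_def)

lemma integral_circle:
  fixes f :: "real \<Rightarrow> real"
  assumes "f \<in> borel_measurable borel"
  shows "integral\<^sup>L circle f = (\<integral>x. f x * indicator torus_range x \<partial>lborel) / (2 * pi)"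
proof -
  have "integral\<^sup>L circle f = (\<integral>x. (indicator torus_range x / (2 * pi)) *\<^sub>R f x \<partial>lborel)"
    unfolding circle_def using assms by (intro integral_density) auto
  also have "\<dots> = (\<integral>x. (f x * indicator torus_range x) / (2 * pi) \<partial>lborel)"
    by (intro Bochner_Integration.integral_cong) auto
  finally show ?thesis by simp
qed

lemma prob_space_circle: "prob_space circle"
proof
  have "emeasure circle (space circle) = (\<integral>\<^sup>+x. ennreal (1 / (2 * pi)) * indicator torus_range x \<partial>lborel)"
    unfolding circle_def
    by (subst emeasure_density)
       (auto intro!: nn_integral_cong simp: indicator_def)
  also have "\<dots> = ennreal (1 / (2 * pi)) * emeasure lborel torus_range"
    by (rule nn_integral_cmult_indicator) auto
  also have "\<dots> = 1" by (simp add: ennreal_mult[symmetric])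
  finally show "emeasure circle (space circle) = 1" .
qed

lemma AE_circle: "AE x in circle. x \<in> torus_range"
proof -
  have "AE x in lborel. 0 < ennreal (indicator torus_range x / (2 * pi)) \<longrightarrow> x \<in> torus_range"
    by (rule AE_I2) (auto simp: indicator_def)
  then show ?thesis unfolding circle_def by (subst AE_density) auto
qed

interpretation circle: prob_space circle by (rule prob_space_circle)
interpretation torus: pair_prob_space circle circle ..

abbreviation torus :: "(real \<times> real) measure" where
  "torus \<equiv> circle \<Otimes>\<^sub>M circle"

lemma integrable_torus:
  fixes f :: "real \<times> real \<Rightarrow> 'b::{banach,second_countable_topology}"
  assumes "f \<in> borel_measurable torus" "\<And>x. norm (f x) \<le> B"
  shows "integrable torus f"
  using assms by (intro torus.P.integrable_const_bound[of _ B]) auto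

lemma circle_cos_int: "(\<integral>u. cos (u * of_int a) \<partial>circle) = (if a = 0 then 1 else 0)"
proof (cases "a = 0")
  case True
  then show ?thesis using circle.prob_space by simp
next
  case False
  have "(\<integral>u. cos (u * of_int a) * indicator torus_range u \<partial>lborel)
      = sin (3*pi/2 * of_int a) / of_int a - sin (- (pi/2) * of_int a) / of_int a"
    by (rule integral_FTC_Icc_real)
       (use False in \<open>auto intro!: derivative_eq_intros continuous_intros\<close>)
  also have "sin (3*pi/2 * of_int a) = sin (- (pi/2) * of_int a + of_int a * (2 * pi))"
    by (rule arg_cong[of _ _ sin]) (simp add: field_simps)
  also have "\<dots> = sin (- (pi/2) * of_int a)"
    using sin.plus_of_int[of "- (pi/2) * of_int a" a] by simp
  finally show ?thesis using False by (subst integral_circle) auto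
qed

lemma circle_sin_int: "(\<integral>u. sin (u * of_int a) \<partial>circle) = 0"
proof (cases "a = 0")
  case False
  have "(\<integral>u. sin (u * of_int a) * indicator torus_range u \<partial>lborel)
      = - cos (3*pi/2 * of_int a) / of_int a - (- cos (- (pi/2) * of_int a) / of_int a)"
    by (rule integral_FTC_Icc_real)
       (use False in \<open>auto intro!: derivative_eq_intros continuous_intros\<close>)
  also have "cos (3*pi/2 * of_int a) = cos (- (pi/2) * of_int a + of_int a * (2 * pi))"
    by (rule arg_cong[of _ _ cos]) (simp add: field_simps)
  also have "\<dots> = cos (- (pi/2) * of_int a)"
    using cos.plus_of_int[of "- (pi/2) * of_int a" a] by simp
  finally show ?thesis using False by (subst integral_circle) auto
qed simp

lemma integral_torus_product:
  fixes f g :: "real \<Rightarrow> real"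
  assumes [measurable]: "f \<in> borel_measurable borel" "g \<in> borel_measurable borel"
    and "\<And>x. \<bar>f x\<bar> \<le> 1" "\<And>x. \<bar>g x\<bar> \<le> 1"
  shows "(\<integral>(u, v). f u * g v \<partial>torus) = integral\<^sup>L circle f * integral\<^sup>L circle g"
    and "integrable torus (\<lambda>(u, v). f u * g v)"
proof -
  show int: "integrable torus (\<lambda>(u, v). f u * g v)"
    by (rule integrable_torus[of _ 1])
       (use assms in \<open>auto simp: abs_mult intro!: mult_le_one split: prod.splits\<close>)
  show "(\<integral>(u, v). f u * g v \<partial>torus) = integral\<^sup>L circle f * integral\<^sup>L circle g"
    using torus.integral_fst[OF int] by simp
qed

lemma torus_orthogonality:
  "(\<integral>(u, v). cos (u * of_int a + v * of_int b) \<partial>torus) = (if a = 0 \<and> b = 0 then 1 else 0)"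
proof -
  have "(\<integral>(u, v). cos (u * of_int a + v * of_int b) \<partial>torus)
      = (\<integral>x. (\<lambda>(u, v). cos (u * of_int a) * cos (v * of_int b)) x
          - (\<lambda>(u, v). sin (u * of_int a) * sin (v * of_int b)) x \<partial>torus)"
    by (rule Bochner_Integration.integral_cong) (auto simp: cos_add)
  also have "\<dots> = (if a = 0 \<and> b = 0 then 1 else 0)"
    by (subst Bochner_Integration.integral_diff)
       (auto simp: integral_torus_product circle_cos_int circle_sin_int)
  finally show ?thesis .
qed

text \<open>Integrating over the whole line instead of one period only increases the value, and
  yields a multiple of a normal density of variance \<open>1 / (2 * c)\<close>.\<close>

lemma circle_gaussian:
  assumes "0 < c"
  shows "(\<integral>\<^sup>+x. ennreal (exp (- c * (x - m)\<^sup>2)) \<partial>circle) \<le> ennreal (sqrt (pi / c) / (2 * pi))"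
proof -
  define \<sigma> where "\<sigma> = sqrt (1 / (2 * c))"
  have \<sigma>: "\<sigma> > 0" "\<sigma>\<^sup>2 = 1 / (2 * c)" using assms by (auto simp: \<sigma>_def)
  have g: "exp (- c * (x - m)\<^sup>2) = sqrt (pi / c) * normal_density m \<sigma> x" for x
    using assms unfolding normal_density_def \<sigma>(2) by (simp add: real_sqrt_divide mult.commute)
  have "(\<integral>\<^sup>+x. ennreal (exp (- c * (x - m)\<^sup>2)) \<partial>circle)
     \<le> (\<integral>\<^sup>+x. ennreal (sqrt (pi / c) / (2 * pi)) * ennreal (normal_density m \<sigma> x) \<partial>lborel)"
    unfolding circle_def g using assms
    by (subst nn_integral_density)
       (auto intro!: nn_integral_mono simp: ennreal_mult[symmetric] indicator_def mult.commute)
  also have "\<dots> = ennreal (sqrt (pi / c) / (2 * pi)) * (\<integral>\<^sup>+x. ennreal (normal_density m \<sigma> x) \<partial>lborel)"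
    by (rule nn_integral_cmult) auto
  also have "(\<integral>\<^sup>+x. ennreal (normal_density m \<sigma> x) \<partial>lborel) = 1"
    using \<sigma> by (subst nn_integral_eq_integral) (auto simp: integral_normal_density)
  finally show ?thesis by simp
qed

subsection \<open>The characteristic function of a step with horizontal instruction\<close>

definition char_mod :: "real \<Rightarrow> real \<Rightarrow> real \<Rightarrow> real" where
  "char_mod p u v = cmod (of_real (p * (cos u + cos v) / 2) + of_real (1 - p) * cis u)"

lemma char_mod_nonneg [simp]: "0 \<le> char_mod p u v"
  by (simp add: char_mod_def)

lemma char_mod_measurable [measurable]:
  "(\<lambda>x. char_mod p (fst x) (snd x)) \<in> borel_measurable (borel \<Otimes>\<^sub>M borel)"
  unfolding char_mod_def cmod_def by simp

text \<open>An expansion in the quantities \<open>1 - cos u\<close> and \<open>1 - cos v\<close>,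
  small near 0. Their linear coefficients \<open>p * (3 - 2*p)\<close> and \<open>p\<close> are the
  source of \<open>sqrt (3 - 2*p)\<close> in the threshold.\<close>

lemma char_mod_square:
  "(char_mod p u v)\<^sup>2 = 1 - p * (3 - 2*p) * (1 - cos u) - p * (1 - cos v)
     + (1 - p) * p * (1 - cos u) * ((1 - cos u) + (1 - cos v))
     + p\<^sup>2 / 4 * ((1 - cos u) + (1 - cos v))\<^sup>2"
proof -
  have "(char_mod p u v)\<^sup>2 = (p * (cos u + cos v) / 2 + (1 - p) * cos u)\<^sup>2 + (1 - p)\<^sup>2 * (sin u)\<^sup>2"
    by (simp add: char_mod_def cmod_power2 power_mult_distrib)
  also have "\<dots> = (p * (cos u + cos v) / 2 + (1 - p) * cos u)\<^sup>2 + (1 - p)\<^sup>2 * (1 - (cos u)\<^sup>2)"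
    by (simp only: sin_squared_eq)
  finally show ?thesis by (simp add: field_simps power2_eq_square)
qed

lemma char_mod_le:
  assumes "0 \<le> p" "p \<le> 1"
  shows "char_mod p u v \<le> (1 - p) + p * \<bar>cos u + cos v\<bar> / 2"
proof -
  have "char_mod p u v \<le> cmod (of_real (p * (cos u + cos v) / 2)) + cmod (of_real (1 - p) * cis u)"
    unfolding char_mod_def by (rule norm_triangle_ineq)
  also have "\<dots> = p * \<bar>cos u + cos v\<bar> / 2 + (1 - p)"
    using assms unfolding norm_of_real norm_mult norm_cis by (simp add: abs_mult)
  finally show ?thesis by simp
qed

lemma char_mod_le_1:
  assumes "0 \<le> p" "p \<le> 1"
  shows "char_mod p u v \<le> 1"
proof -
  have "\<bar>cos u + cos v\<bar> \<le> 2" using abs_triangle_ineq[of "cos u" "cos v"] abs_cos_le_one[of u] abs_cos_le_one[of v] by linarith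
  then have "p * \<bar>cos u + cos v\<bar> \<le> p * 2" using assms by (intro mult_left_mono)
  then show ?thesis using char_mod_le[OF assms, of u v] by linarith
qed

text \<open>The Fourier form of parity: \<open>(pi, pi)\<close> is a second point of modulus 1,
  which doubles the main term.\<close>

lemma char_mod_shift_pi: "char_mod p (u - pi) (v - pi) = char_mod p u v"
proof -
  have "cis (u - pi) = - cis u" by (simp add: complex_eq_iff)
  then have "of_real (p * (cos (u - pi) + cos (v - pi)) / 2) + of_real (1 - p) * cis (u - pi)
     = - (of_real (p * (cos u + cos v) / 2) + of_real (1 - p) * cis u)"
    by (simp add: field_simps)
  then show ?thesis unfolding char_mod_def by (metis norm_minus_cancel)
qed

lemma one_minus_cos_lower:
  fixes \<epsilon> :: real
  assumes "0 < \<epsilon>"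
  shows "\<exists>\<delta>>0. \<forall>u. \<bar>u\<bar> < \<delta> \<longrightarrow> (1 - \<epsilon>) * (u\<^sup>2 / 2) \<le> 1 - cos u"
proof -
  have "((\<lambda>h. (sin h / h)\<^sup>2) \<longlongrightarrow> 1\<^sup>2) (at (0::real))"
    using DERIV_sin[of "0::real"] by (intro tendsto_power) (simp add: DERIV_def)
  then have "eventually (\<lambda>h. 1 - \<epsilon> < (sin h / h)\<^sup>2) (at (0::real))"
    using assms by (intro order_tendstoD) auto
  then obtain d where d: "d > 0" "\<And>h. h \<noteq> 0 \<Longrightarrow> \<bar>h\<bar> < d \<Longrightarrow> 1 - \<epsilon> < (sin h / h)\<^sup>2"
    by (auto simp: eventually_at dist_real_def)
  have "(1 - \<epsilon>) * (u\<^sup>2 / 2) \<le> 1 - cos u" if "\<bar>u\<bar> < d" for u :: real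
  proof (cases "u = 0")
    case False
    then have "1 - \<epsilon> \<le> (sin (u/2) / (u/2))\<^sup>2" using d(2)[of "u/2"] that d(1) by auto
    then have "(1 - \<epsilon>) * (u/2)\<^sup>2 \<le> (sin (u/2))\<^sup>2"
      using False by (simp add: power_divide pos_le_divide_eq field_simps)
    moreover have "1 - cos u = 2 * (sin (u/2))\<^sup>2" using cos_double_sin[of "u/2"] by simp
    ultimately show ?thesis by (simp add: power_divide)
  qed simp
  with d(1) show ?thesis by blast
qed

lemma one_minus_cos_upper: "1 - cos u \<le> u\<^sup>2 / 2" for u :: real
proof -
  have "(sin (u/2))\<^sup>2 \<le> (u/2)\<^sup>2" using abs_sin_x_le_abs_x[of "u/2"] by (simp only: abs_le_square_iff)
  moreover have "1 - cos u = 2 * (sin (u/2))\<^sup>2" using cos_double_sin[of "u/2"] by simp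
  ultimately show ?thesis by (simp add: power_divide)
qed

lemma cos_le_away:
  assumes "0 \<le> \<delta>" "\<delta> \<le> pi/2" "\<delta> \<le> \<bar>u\<bar>" "\<bar>u\<bar> \<le> 3*pi/2"
  shows "cos u \<le> cos \<delta>"
proof (cases "\<bar>u\<bar> \<le> pi")
  case True
  then show ?thesis using cos_monotone_0_pi_le[of \<delta> "\<bar>u\<bar>"] assms by simp
next
  case False
  then have "0 \<le> cos (\<bar>u\<bar> - pi)" using assms by (intro cos_ge_zero) auto
  moreover have "cos (\<bar>u\<bar> - pi) = - cos u" by (simp add: cos_diff)
  moreover have "0 \<le> cos \<delta>" using assms pi_ge_zero by (intro cos_ge_zero) linarith+
  ultimately show ?thesis by simp
qed

text \<open>One factor \<open>1 - \<epsilon>\<close> absorbs the quadratic terms of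
  \<open>char_mod_square\<close>, the other the error in replacing \<open>1 - cos u\<close> by
  \<open>u\<^sup>2 / 2\<close>. Then \<open>1 - x \<le> exp (- x)\<close> applies to the square of
  the modulus.\<close>

lemma char_mod_local:
  assumes p: "0 \<le> p" "p \<le> 1" and \<epsilon>: "0 < \<epsilon>" "\<epsilon> < 1"
  shows "\<exists>\<delta>>0. \<delta> \<le> pi/2 \<and> (\<forall>u v. \<bar>u\<bar> < \<delta> \<longrightarrow> \<bar>v\<bar> < \<delta> \<longrightarrow>
     char_mod p u v \<le> exp (- ((1 - \<epsilon>)\<^sup>2 * p * (3 - 2*p) / 4) * u\<^sup>2) * exp (- ((1 - \<epsilon>)\<^sup>2 * p / 4) * v\<^sup>2))"
proof -
  obtain d where d: "d > 0" "\<And>u. \<bar>u\<bar> < d \<Longrightarrow> (1 - \<epsilon>) * (u\<^sup>2 / 2) \<le> 1 - cos u"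
    using one_minus_cos_lower[OF \<epsilon>(1)] by blast
  \<comment> \<open>The bound \<open>sqrt \<epsilon>\<close> gives
    \<open>A + B \<le> \<epsilon>\<close> below; \<open>pi/2\<close> is needed later for
    \<open>cos_le_away\<close>.\<close>
  define \<delta> where "\<delta> = min d (min (sqrt \<epsilon>) (pi/2))"
  have \<delta>: "\<delta> > 0" "\<delta> \<le> pi/2" "\<delta> \<le> d" "\<delta> \<le> sqrt \<epsilon>"
    using d \<epsilon> by (auto simp: \<delta>_def)
  have "char_mod p u v \<le> exp (- ((1 - \<epsilon>)\<^sup>2 * p * (3 - 2*p) / 4) * u\<^sup>2) * exp (- ((1 - \<epsilon>)\<^sup>2 * p / 4) * v\<^sup>2)"
    if uv: "\<bar>u\<bar> < \<delta>" "\<bar>v\<bar> < \<delta>" for u v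
  proof -
    define A B where "A = 1 - cos u" and "B = 1 - cos v"
    have sq: "u\<^sup>2 \<le> \<epsilon>" "v\<^sup>2 \<le> \<epsilon>"
      using uv \<delta>(4) \<epsilon> by (auto simp: real_le_rsqrt abs_le_square_iff sqrt_ge_absD)
    have A: "0 \<le> A" "A \<le> u\<^sup>2 / 2" "(1 - \<epsilon>) * (u\<^sup>2 / 2) \<le> A"
      using one_minus_cos_upper[of u] d(2)[of u] uv \<delta> by (auto simp: A_def)
    have B: "0 \<le> B" "B \<le> v\<^sup>2 / 2" "(1 - \<epsilon>) * (v\<^sup>2 / 2) \<le> B"
      using one_minus_cos_upper[of v] d(2)[of v] uv \<delta> by (auto simp: B_def)
    have AB: "A + B \<le> \<epsilon>" using A B sq by linarith
    have "(1 - p) * p * A * (A + B) + p\<^sup>2 / 4 * (A + B)\<^sup>2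
       \<le> (1 - p) * p * (A + B) * \<epsilon> + p\<^sup>2 * ((A + B) * \<epsilon>)"
    proof (rule add_mono)
      show "(1 - p) * p * A * (A + B) \<le> (1 - p) * p * (A + B) * \<epsilon>"
        using p A B AB \<epsilon> by (intro mult_mono) auto
      have "p\<^sup>2 / 4 * ((A + B) * (A + B)) \<le> p\<^sup>2 * ((A + B) * \<epsilon>)"
        using p A B AB \<epsilon> by (intro mult_mono) auto
      then show "p\<^sup>2 / 4 * (A + B)\<^sup>2 \<le> p\<^sup>2 * ((A + B) * \<epsilon>)" by (simp only: power2_eq_square)
    qed
    also have "\<dots> = p * \<epsilon> * 1 * A + p * \<epsilon> * B" by (simp add: algebra_simps power2_eq_square)
    also have "\<dots> \<le> p * \<epsilon> * (3 - 2*p) * A + p * \<epsilon> * B"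
      using p A \<epsilon> by (intro add_mono mult_right_mono mult_left_mono) auto
    finally have "(char_mod p u v)\<^sup>2 \<le> 1 + (- ((1 - \<epsilon>) * (p * (3 - 2*p) * A + p * B)))"
      unfolding char_mod_square A_def[symmetric] B_def[symmetric] by (simp add: algebra_simps)
    also have "\<dots> \<le> exp (- ((1 - \<epsilon>) * (p * (3 - 2*p) * A + p * B)))"
      by (rule exp_ge_add_one_self)
    also have "\<dots> \<le> exp (- ((1 - \<epsilon>) * (p * (3 - 2*p) * ((1 - \<epsilon>) * (u\<^sup>2 / 2)) + p * ((1 - \<epsilon>) * (v\<^sup>2 / 2)))))"
      using p \<epsilon> A B by (simp only: exp_le_cancel_iff neg_le_iff_le) (intro mult_left_mono add_mono; simp)
    also have "\<dots> = (exp (- ((1 - \<epsilon>)\<^sup>2 * p * (3 - 2*p) / 4) * u\<^sup>2) * exp (- ((1 - \<epsilon>)\<^sup>2 * p / 4) * v\<^sup>2))\<^sup>2"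
      unfolding exp_add[symmetric] exp_double[symmetric]
      by (rule arg_cong[of _ _ exp]) (simp add: field_simps power2_eq_square)
    finally show ?thesis by (rule power2_le_imp_le) simp
  qed
  with \<delta> show ?thesis by blast
qed

text \<open>The Gaussian bound holds near \<open>(0, 0)\<close> and, by the shift, near
  \<open>(pi, pi)\<close>; elsewhere the modulus is at most a fixed number below 1.\<close>

lemma char_mod_power_bound:
  assumes p: "0 < p" "p \<le> 1" and \<epsilon>: "0 < \<epsilon>" "\<epsilon> < 1"
  defines "a \<equiv> (1 - \<epsilon>)\<^sup>2 * p * (3 - 2*p) / 4" and "b \<equiv> (1 - \<epsilon>)\<^sup>2 * p / 4"
  shows "\<exists>\<rho>\<ge>0. \<rho> < 1 \<and> (\<forall>n u v. u \<in> torus_range \<longrightarrow> v \<in> torus_range \<longrightarrow>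
     char_mod p u v ^ n \<le> exp (- (real n * a) * u\<^sup>2) * exp (- (real n * b) * v\<^sup>2)
       + exp (- (real n * a) * (u - pi)\<^sup>2) * exp (- (real n * b) * (v - pi)\<^sup>2) + \<rho> ^ n)"
proof -
  obtain \<delta> where \<delta>: "0 < \<delta>" "\<delta> \<le> pi/2" and
    loc: "\<And>u v. \<bar>u\<bar> < \<delta> \<Longrightarrow> \<bar>v\<bar> < \<delta> \<Longrightarrow> char_mod p u v \<le> exp (- a * u\<^sup>2) * exp (- b * v\<^sup>2)"
    using char_mod_local[of p \<epsilon>] p \<epsilon> unfolding a_def b_def by auto
  have pow: "(exp (- a * x) * exp (- b * y)) ^ n = exp (- (real n * a) * x) * exp (- (real n * b) * y)"
    for x y n by (simp add: power_mult_distrib exp_of_nat_mult[symmetric] mult_ac)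
  define \<rho> where "\<rho> = (1 - p) + p * (1 + cos \<delta>) / 2"
  have cd: "0 \<le> cos \<delta>" "cos \<delta> < 1"
    using \<delta> cos_monotone_0_pi[of 0 \<delta>] pi_gt_zero by (auto intro: cos_ge_zero)
  have "p * (1 + cos \<delta>) < p * 2" using cd p by (intro mult_strict_left_mono) auto
  then have \<rho>: "0 \<le> \<rho>" "\<rho> < 1" using p cd by (auto simp: \<rho>_def)
  have "char_mod p u v ^ n \<le> exp (- (real n * a) * u\<^sup>2) * exp (- (real n * b) * v\<^sup>2)
       + exp (- (real n * a) * (u - pi)\<^sup>2) * exp (- (real n * b) * (v - pi)\<^sup>2) + \<rho> ^ n"
    if uv: "u \<in> torus_range" "v \<in> torus_range" for n u v
  proof -
    consider "\<bar>u\<bar> < \<delta>" "\<bar>v\<bar> < \<delta>" | "\<bar>u - pi\<bar> < \<delta>" "\<bar>v - pi\<bar> < \<delta>"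
      | "\<delta> \<le> \<bar>u\<bar> \<or> \<delta> \<le> \<bar>v\<bar>" "\<delta> \<le> \<bar>u - pi\<bar> \<or> \<delta> \<le> \<bar>v - pi\<bar>"
      by linarith
    then show ?thesis
    proof cases
      case 1
      have "char_mod p u v ^ n \<le> (exp (- a * u\<^sup>2) * exp (- b * v\<^sup>2)) ^ n"
        by (intro power_mono loc 1) simp
      moreover have "0 \<le> exp (- (real n * a) * (u - pi)\<^sup>2) * exp (- (real n * b) * (v - pi)\<^sup>2) + \<rho> ^ n"
        using \<rho> by simp
      ultimately show ?thesis unfolding pow by linarith
    next
      case 2
      have "char_mod p u v ^ n \<le> (exp (- a * (u - pi)\<^sup>2) * exp (- b * (v - pi)\<^sup>2)) ^ n"
        unfolding char_mod_shift_pi[of p u v, symmetric] by (intro power_mono loc 2) simp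
      moreover have "0 \<le> exp (- (real n * a) * u\<^sup>2) * exp (- (real n * b) * v\<^sup>2)" "0 \<le> \<rho> ^ n"
        using \<rho> by simp_all
      ultimately show ?thesis unfolding pow by linarith
    next
      case 3
      have bd: "\<bar>x\<bar> \<le> 3*pi/2" "\<bar>x - pi\<bar> \<le> 3*pi/2" if "x \<in> torus_range" for x
        using that pi_ge_zero unfolding atLeastAtMost_iff abs_le_iff by linarith+
      \<comment> \<open>Distance from \<open>(0, 0)\<close> bounds the cosine sum from above,
        distance from \<open>(pi, pi)\<close> bounds it from below.\<close>
      have 1: "cos u + cos v \<le> 1 + cos \<delta>"
        using 3(1) cos_le_away[of \<delta> u] cos_le_away[of \<delta> v] \<delta> bd[OF uv(1)] bd[OF uv(2)]
          cos_le_one[of u] cos_le_one[of v] by argo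
      have "cos (u - pi) + cos (v - pi) \<le> 1 + cos \<delta>"
        using 3(2) cos_le_away[of \<delta> "u - pi"] cos_le_away[of \<delta> "v - pi"] \<delta> bd[OF uv(1)] bd[OF uv(2)]
          cos_le_one[of "u - pi"] cos_le_one[of "v - pi"] by argo
      then have "- (cos u + cos v) \<le> 1 + cos \<delta>" by (simp add: cos_diff)
      with 1 have "\<bar>cos u + cos v\<bar> \<le> 1 + cos \<delta>" by linarith
      then have "p * \<bar>cos u + cos v\<bar> \<le> p * (1 + cos \<delta>)" using p by (intro mult_left_mono) auto
      then have "char_mod p u v \<le> \<rho>" using char_mod_le[of p u v] p unfolding \<rho>_def by linarith
      then have "char_mod p u v ^ n \<le> \<rho> ^ n" by (intro power_mono) auto
      then show ?thesis by (simp add: add_nonneg_nonneg add_increasing)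
    qed
  qed
  with \<rho> show ?thesis by blast
qed

text \<open>Each of the two Gaussians contributes at most
  \<open>1 / (4 * pi * n * sqrt (a * b))\<close>, where \<open>sqrt (a * b)\<close> is
  \<open>p * sqrt (3 - 2*p) / 4\<close> up to the factor
  \<open>(1 - \<epsilon>)\<^sup>2\<close>.\<close>

lemma char_mod_integral_bound:
  assumes p: "0 < p" "p \<le> 1" and \<epsilon>: "0 < \<epsilon>" "\<epsilon> < 1"
  shows "\<exists>\<rho>\<ge>0. \<rho> < 1 \<and> (\<forall>n\<ge>1. (\<integral>(u, v). char_mod p u v ^ n \<partial>torus)
     \<le> 2 / (pi * p * sqrt (3 - 2*p) * (1 - \<epsilon>)\<^sup>2) / real n + \<rho> ^ n)"
proof -
  define a b where "a = (1 - \<epsilon>)\<^sup>2 * p * (3 - 2*p) / 4" and "b = (1 - \<epsilon>)\<^sup>2 * p / 4"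
  have ab: "0 < a" "0 < b" using p \<epsilon> by (auto simp: a_def b_def)
  have "a * b = ((1 - \<epsilon>)\<^sup>2 * p / 4)\<^sup>2 * (3 - 2*p)"
    by (simp add: a_def b_def power2_eq_square)
  then have sab: "sqrt (a * b) = (1 - \<epsilon>)\<^sup>2 * p / 4 * sqrt (3 - 2*p)"
    using p by (simp add: real_sqrt_mult)
  obtain \<rho> where \<rho>: "0 \<le> \<rho>" "\<rho> < 1" and bound: "\<And>n u v. u \<in> torus_range \<Longrightarrow> v \<in> torus_range \<Longrightarrow>
     char_mod p u v ^ n \<le> exp (- (real n * a) * (u - 0)\<^sup>2) * exp (- (real n * b) * (v - 0)\<^sup>2)
       + exp (- (real n * a) * (u - pi)\<^sup>2) * exp (- (real n * b) * (v - pi)\<^sup>2) + \<rho> ^ n"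
    using char_mod_power_bound[OF assms] unfolding a_def b_def by auto
  have "(\<integral>(u, v). char_mod p u v ^ n \<partial>torus)
     \<le> 2 / (pi * p * sqrt (3 - 2*p) * (1 - \<epsilon>)\<^sup>2) / real n + \<rho> ^ n" if n: "n \<ge> 1" for n
  proof -
    let ?g = "\<lambda>c m x. ennreal (exp (- (real n * c) * (x - m)\<^sup>2))"
    let ?X = "sqrt (pi / (real n * a)) / (2 * pi) * (sqrt (pi / (real n * b)) / (2 * pi))"
    have int: "integrable torus (\<lambda>(u, v). char_mod p u v ^ n)"
    proof (rule integrable_torus[of _ 1])
      show "(\<lambda>(u, v). char_mod p u v ^ n) \<in> borel_measurable torus"
        unfolding split_beta by measurable
    qed (use p in \<open>auto intro!: power_le_one char_mod_le_1\<close>)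
    have X0: "0 \<le> ?X" using ab by simp
    have gg: "(\<integral>\<^sup>+u. \<integral>\<^sup>+v. ?g a m u * ?g b m v \<partial>circle \<partial>circle) \<le> ennreal ?X" for m
    proof -
      have "(\<integral>\<^sup>+u. \<integral>\<^sup>+v. ?g a m u * ?g b m v \<partial>circle \<partial>circle)
         = (\<integral>\<^sup>+u. ?g a m u \<partial>circle) * (\<integral>\<^sup>+v. ?g b m v \<partial>circle)"
        by (subst nn_integral_cmult, measurable, subst nn_integral_multc, measurable)
      also have "\<dots> \<le> ennreal (sqrt (pi / (real n * a)) / (2 * pi)) * ennreal (sqrt (pi / (real n * b)) / (2 * pi))"
        using ab n by (intro mult_mono circle_gaussian) auto
      also have "\<dots> = ennreal ?X" using ab by (subst ennreal_mult) auto
      finally show ?thesis .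
    qed
    have "ennreal (\<integral>(u, v). char_mod p u v ^ n \<partial>torus) = (\<integral>\<^sup>+x. ennreal (case x of (u, v) \<Rightarrow> char_mod p u v ^ n) \<partial>torus)"
      using int by (intro nn_integral_eq_integral[symmetric]) (auto split: prod.splits)
    also have "\<dots> = (\<integral>\<^sup>+u. \<integral>\<^sup>+v. ennreal (char_mod p u v ^ n) \<partial>circle \<partial>circle)"
      using int by (subst circle.nn_integral_fst[symmetric]) auto
    also have "\<dots> \<le> (\<integral>\<^sup>+u. \<integral>\<^sup>+v. ?g a 0 u * ?g b 0 v + ?g a pi u * ?g b pi v + ennreal (\<rho> ^ n) \<partial>circle \<partial>circle)"
    proof -
      have *: "ennreal (char_mod p u v ^ n) \<le> ?g a 0 u * ?g b 0 v + ?g a pi u * ?g b pi v + ennreal (\<rho> ^ n)"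
        if "u \<in> torus_range" "v \<in> torus_range" for u v
        using bound[OF that, of n] \<rho>
        by (simp only: ennreal_mult[symmetric] ennreal_plus[symmetric] exp_ge_zero
            mult_nonneg_nonneg add_nonneg_nonneg zero_le_power ennreal_leI)
      have "AE v in circle. ennreal (char_mod p u v ^ n)
          \<le> ?g a 0 u * ?g b 0 v + ?g a pi u * ?g b pi v + ennreal (\<rho> ^ n)"
        if "u \<in> torus_range" for u
        using AE_circle by (rule eventually_mono) (rule *[OF that])
      then have "(\<integral>\<^sup>+v. ennreal (char_mod p u v ^ n) \<partial>circle)
          \<le> (\<integral>\<^sup>+v. ?g a 0 u * ?g b 0 v + ?g a pi u * ?g b pi v + ennreal (\<rho> ^ n) \<partial>circle)"
        if "u \<in> torus_range" for u
        using that by (intro nn_integral_mono_AE)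
      with AE_circle show ?thesis
        by (intro nn_integral_mono_AE) (rule eventually_mono)
    qed
    also have "\<dots> = (\<integral>\<^sup>+u. \<integral>\<^sup>+v. ?g a 0 u * ?g b 0 v \<partial>circle \<partial>circle)
        + (\<integral>\<^sup>+u. \<integral>\<^sup>+v. ?g a pi u * ?g b pi v \<partial>circle \<partial>circle) + ennreal (\<rho> ^ n)"
      using circle.emeasure_space_1 by (simp add: nn_integral_add)
    also have "\<dots> \<le> ennreal ?X + ennreal ?X + ennreal (\<rho> ^ n)"
      by (intro add_mono gg order_refl)
    also have "\<dots> = ennreal (2 * ?X + \<rho> ^ n)"
      using X0 \<rho>(1) by (simp only: ennreal_plus[symmetric] add_nonneg_nonneg zero_le_power mult_2)
    finally have "(\<integral>(u, v). char_mod p u v ^ n \<partial>torus) \<le> 2 * ?X + \<rho> ^ n"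
      using ab \<rho> by (subst (asm) ennreal_le_iff) auto
    also have "2 * ?X = 1 / (2 * pi * real n * sqrt (a * b))"
    proof -
      have "sqrt (pi / (real n * a)) * sqrt (pi / (real n * b)) = sqrt ((pi / real n)\<^sup>2 / (a * b))"
        by (simp add: real_sqrt_mult[symmetric] power2_eq_square)
      also have "\<dots> = pi / real n / sqrt (a * b)" by (simp add: real_sqrt_divide)
      finally show ?thesis by (simp add: field_simps)
    qed
    also have "\<dots> = 2 / (pi * p * sqrt (3 - 2*p) * (1 - \<epsilon>)\<^sup>2) / real n"
      unfolding sab by (simp add: field_simps)
    finally show ?thesis .
  qed
  with \<rho> show ?thesis by blast
qed

subsection \<open>Local limit bound\<close>

text \<open>The AM-GM inequality for the numbers \<open>x i ^ n\<close>. It replaces a product over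
  varying instructions by an average of powers, each belonging to a constant instruction.\<close>

lemma prod_le_mean_power:
  fixes x :: "nat \<Rightarrow> real"
  assumes "\<And>i. 0 \<le> x i" "n \<ge> 1"
  shows "(\<Prod>i<n. x i) \<le> (\<Sum>i<n. x i ^ n) / real n"
proof -
  have "(\<Prod>i<n. x i ^ n) powr (1 / real (card {..<n})) \<le> (\<Sum>i<n. x i ^ n / real (card {..<n}))"
    using assms by (intro arith_geom_mean) (auto simp: lessThan_empty_iff)
  moreover have "(\<Prod>i<n. x i ^ n) powr (1 / real n) = (\<Prod>i<n. x i)"
  proof (cases "(\<Prod>i<n. x i) = 0")
    case True
    show ?thesis unfolding prod_power_distrib[symmetric] True using assms by simp
  next
    case False
    then have "(\<Prod>i<n. x i) > 0" using prod_nonneg[of "{..<n}" x] assms by (auto simp: less_le)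
    then show ?thesis using assms
      by (simp add: prod_power_distrib[symmetric] powr_realpow[symmetric] powr_powr del: prod_zero_iff)
  qed
  ultimately show ?thesis by (simp add: sum_divide_distrib)
qed

context guided_walk
begin

definition chi :: "real \<Rightarrow> real \<Rightarrow> pt \<Rightarrow> complex" where
  "chi u v z = cis (u * of_int (fst z) + v * of_int (snd z))"

definition phi :: "nat \<Rightarrow> real \<Rightarrow> real \<Rightarrow> complex" where
  "phi t u v = of_real (p * (cos u + cos v) / 2) + of_real (1 - p) * chi u v (s t)"

lemma chi_add: "chi u v (y + d) = chi u v y * chi u v d"
  by (simp add: chi_def cis_mult algebra_simps)

lemma norm_chi [simp]: "norm (chi u v z) = 1"
  by (simp add: chi_def)

lemma srw_avg_chi: "srw_avg (chi u v) y = chi u v y * of_real ((cos u + cos v) / 2)"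
proof -
  have "(\<Sum>d\<in>unit_steps. chi u v d) = of_real (2 * (cos u + cos v))"
    by (simp add: sum_unit_steps chi_def complex_eq_iff)
  moreover have "(\<Sum>d\<in>unit_steps. chi u v (y + d)) = chi u v y * (\<Sum>d\<in>unit_steps. chi u v d)"
    by (simp add: chi_add sum_distrib_left)
  ultimately show ?thesis by (simp add: srw_avg_def scaleR_conv_of_real)
qed

lemma step_chi: "step t (\<lambda>z. chi u v z * C) y = chi u v y * phi t u v * C"
proof -
  have "srw_avg (\<lambda>z. chi u v z * C) y = srw_avg (chi u v) y * C"
    by (simp add: srw_avg_def sum_distrib_right)
  then show ?thesis
    by (simp add: step_def phi_def srw_avg_chi chi_add scaleR_conv_of_real algebra_simps)
qed

text \<open>Characters are eigenfunctions of every \<open>step t\<close>. The constant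
  \<open>C\<close> carries the product accumulated in the induction and, later, the factor
  \<open>chi u v (- h)\<close>.\<close>

lemma free_chi: "free t n (\<lambda>z. chi u v z * C) y = chi u v y * (\<Prod>i<n. phi (t + i) u v) * C"
proof (induction n arbitrary: t y)
  case (Suc n)
  have "free t (Suc n) (\<lambda>z. chi u v z * C) y
      = step t (\<lambda>z. chi u v z * ((\<Prod>i<n. phi (Suc t + i) u v) * C)) y"
    by (simp add: Suc.IH[abs_def] mult.assoc)
  also have "\<dots> = chi u v y * (phi t u v * (\<Prod>i<n. phi (t + Suc i) u v)) * C"
    by (simp add: step_chi mult.assoc)
  finally show ?case unfolding prod.lessThan_Suc_shift by simp
qed simp

lemma free_Re: "free t n (\<lambda>z. Re (g z)) y = Re (free t n g y)"
  by (induction n arbitrary: t y) (simp_all add: step_def srw_avg_def)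

text \<open>Opposite directions give complex conjugates, and vertical instructions exchange
  \<open>u\<close> and \<open>v\<close>.\<close>

lemma norm_phi: "norm (phi t u v) = (if snd (s t) = 0 then char_mod p u v else char_mod p v u)"
proof -
  have cnj: "cmod (of_real a + of_real b * cis (- w)) = cmod (of_real a + of_real b * cis w)" for a b w
  proof -
    have "of_real a + of_real b * cis (- w) = cnj (of_real a + of_real b * cis w)"
      by (simp add: cis_cnj)
    then show ?thesis by (metis complex_mod_cnj)
  qed
  define a b where "a = p * (cos u + cos v) / 2" and "b = 1 - p"
  have "phi t u v = of_real a + of_real b * chi u v (s t)"
    "char_mod p u v = cmod (of_real a + of_real b * cis u)"
    "char_mod p v u = cmod (of_real a + of_real b * cis v)"
    unfolding phi_def char_mod_def a_def b_def by (simp_all only: add.commute[of "cos v"])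
  with s_unit[of t] show ?thesis
    by (elim unit_steps_cases) (simp_all add: chi_def cnj)
qed

text \<open>The operators are finite sums, hence commute with integration; this carries Fourier
  inversion through \<open>free\<close>.\<close>

lemma free_integral:
  fixes G :: "'a \<Rightarrow> pt \<Rightarrow> real"
  assumes "\<And>z. integrable M (\<lambda>\<theta>. G \<theta> z)"
  shows "integrable M (\<lambda>\<theta>. free t n (G \<theta>) y)
    \<and> free t n (\<lambda>z. \<integral>\<theta>. G \<theta> z \<partial>M) y = (\<integral>\<theta>. free t n (G \<theta>) y \<partial>M)"
proof (induction n arbitrary: t y)
  case (Suc n)
  then have [simp]: "integrable M (\<lambda>\<theta>. free (Suc t) n (G \<theta>) z)"
    and "free (Suc t) n (\<lambda>z. \<integral>\<theta>. G \<theta> z \<partial>M) = (\<lambda>z. \<integral>\<theta>. free (Suc t) n (G \<theta>) z \<partial>M)" for z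
    by auto
  then show ?case by (simp add: step_def srw_avg_def)
qed (use assms in simp)

lemma point_mass_fourier:
  "point_mass h z = (\<integral>x. Re (chi (fst x) (snd x) z * chi (fst x) (snd x) (- h)) \<partial>torus)"
proof -
  have "(\<integral>x. Re (chi (fst x) (snd x) z * chi (fst x) (snd x) (- h)) \<partial>torus)
     = (\<integral>(u, v). cos (u * of_int (fst z - fst h) + v * of_int (snd z - snd h)) \<partial>torus)"
    by (rule Bochner_Integration.integral_cong)
       (auto simp: chi_def cis_mult algebra_simps)
  then show ?thesis
    unfolding torus_orthogonality by (auto simp: point_mass_def prod_eq_iff)
qed

lemma norm_phi_integrable:
  "integrable torus (\<lambda>x. norm (phi t (fst x) (snd x)) ^ n)"
  and norm_phi_integral:
  "(\<integral>x. norm (phi t (fst x) (snd x)) ^ n \<partial>torus) = (\<integral>(u, v). char_mod p u v ^ n \<partial>torus)"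
proof -
  have int: "integrable torus (\<lambda>(u, v). char_mod p u v ^ n)"
  proof (rule integrable_torus[of _ 1])
    show "(\<lambda>(u, v). char_mod p u v ^ n) \<in> borel_measurable torus"
      unfolding split_beta by measurable
  qed (use p_nonneg p_le_1 in \<open>auto intro!: power_le_one char_mod_le_1\<close>)
  have "integrable torus (\<lambda>(u, v). char_mod p v u ^ n)"
    using torus.integrable_product_swap[OF int] by (simp add: split_beta)
  then show "integrable torus (\<lambda>x. norm (phi t (fst x) (snd x)) ^ n)"
    using int unfolding norm_phi split_beta by (cases "snd (s t) = 0") simp_all
  have "(\<integral>(u, v). char_mod p v u ^ n \<partial>torus) = (\<integral>(u, v). char_mod p u v ^ n \<partial>torus)"
    using torus.integral_product_swap[OF borel_measurable_integrable[OF int]] by (simp add: split_beta)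
  then show "(\<integral>x. norm (phi t (fst x) (snd x)) ^ n \<partial>torus) = (\<integral>(u, v). char_mod p u v ^ n \<partial>torus)"
    unfolding norm_phi split_beta by (cases "snd (s t) = 0") simp_all
qed

text \<open>The Fourier integrand is bounded by its modulus, a product; after
  \<open>prod_le_mean_power\<close> all \<open>n\<close> terms have the same integral, since
  exchanging the torus coordinates preserves the measure.\<close>

lemma free_point_mass_le:
  assumes "n \<ge> 1"
  shows "free t n (point_mass h) y \<le> (\<integral>(u, v). char_mod p u v ^ n \<partial>torus)"
proof -
  let ?G = "\<lambda>x z. chi (fst x) (snd x) z * chi (fst x) (snd x) (- h)"
  let ?P = "\<lambda>i x. norm (phi (t + i) (fst x) (snd x))"
  have G: "integrable torus (\<lambda>x. Re (?G x z))" for z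
  proof (rule integrable_torus[of _ 1])
    have "(\<lambda>x. Re (?G x z)) = (\<lambda>x. cos (fst x * of_int (fst z - fst h) + snd x * of_int (snd z - snd h)))"
      by (auto simp: chi_def cis_mult algebra_simps)
    then show "(\<lambda>x. Re (?G x z)) \<in> borel_measurable torus" by simp
    show "norm (Re (?G x z)) \<le> 1" for x
      using abs_Re_le_cmod[of "?G x z"] by (simp add: norm_mult)
  qed
  note free_int = free_integral[where M = torus and G = "\<lambda>x z. Re (?G x z)", OF G, of t n y]
  have "free t n (point_mass h) y = free t n (\<lambda>z. \<integral>x. Re (?G x z) \<partial>torus) y"
    using point_mass_fourier[of h] by presburger
  also have "\<dots> = (\<integral>x. free t n (\<lambda>z. Re (?G x z)) y \<partial>torus)"
    using free_int by blast
  also have "\<dots> \<le> (\<integral>x. (\<Sum>i<n. ?P i x ^ n) / real n \<partial>torus)"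
  proof (rule integral_mono)
    show "integrable torus (\<lambda>x. free t n (\<lambda>z. Re (?G x z)) y)"
      using free_int by blast
    show "integrable torus (\<lambda>x. (\<Sum>i<n. ?P i x ^ n) / real n)"
      by (intro integrable_divide Bochner_Integration.integrable_sum norm_phi_integrable)
    fix x
    have "free t n (\<lambda>z. Re (?G x z)) y \<le> norm (free t n (?G x) y)"
      unfolding free_Re by (rule complex_Re_le_cmod)
    also have "\<dots> = (\<Prod>i<n. ?P i x)" unfolding free_chi by (simp add: norm_mult prod_norm)
    also have "\<dots> \<le> (\<Sum>i<n. ?P i x ^ n) / real n" using assms by (intro prod_le_mean_power) auto
    finally show "free t n (\<lambda>z. Re (?G x z)) y \<le> (\<Sum>i<n. ?P i x ^ n) / real n" .
  qed
  also have "\<dots> = (\<integral>(u, v). char_mod p u v ^ n \<partial>torus)"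
    using assms by (simp add: Bochner_Integration.integral_sum norm_phi_integrable norm_phi_integral)
  finally show ?thesis .
qed

text \<open>The slack in \<open>c\<close> pays first for the loss in \<open>\<epsilon>\<close> and
  then for the exponentially small \<open>\<rho> ^ n\<close>. The bound is uniform in the starting
  time, the starting point and the target.\<close>

lemma local_limit_bound:
  assumes p: "0 < p" and c: "2 / (pi * p * sqrt (3 - 2*p)) < c"
  shows "\<exists>K\<ge>1. \<forall>n\<ge>K. \<forall>t h y. free t n (point_mass h) y \<le> c / real n"
proof -
  let ?c = "2 / (pi * p * sqrt (3 - 2*p))"
  have c0: "0 < ?c" using p p_le_1 by simp
  have "((\<lambda>\<epsilon>. ?c / (1 - \<epsilon>)\<^sup>2) \<longlongrightarrow> ?c / (1 - 0)\<^sup>2) (at_right 0)"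
    by (intro tendsto_intros) auto
  then have "eventually (\<lambda>\<epsilon>. ?c / (1 - \<epsilon>)\<^sup>2 < c) (at_right 0)"
    using c by (intro order_tendstoD) auto
  moreover have "eventually (\<lambda>\<epsilon>::real. \<epsilon> < 1) (at_right 0)"
    by (rule order_tendstoD[OF tendsto_ident_at]) simp
  moreover have "eventually (\<lambda>\<epsilon>::real. \<epsilon> > 0) (at_right 0)"
    by (rule eventually_at_right_less)
  ultimately have "eventually (\<lambda>\<epsilon>. ?c / (1 - \<epsilon>)\<^sup>2 < c \<and> \<epsilon> < 1 \<and> \<epsilon> > 0) (at_right 0)"
    by (auto intro: eventually_conj)
  then obtain \<epsilon> where \<epsilon>: "?c / (1 - \<epsilon>)\<^sup>2 < c" "\<epsilon> < 1" "0 < \<epsilon>"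
    using eventually_happens'[OF trivial_limit_at_right_real] by blast
  define c1 where "c1 = 2 / (pi * p * sqrt (3 - 2*p) * (1 - \<epsilon>)\<^sup>2)"
  have c1: "c1 < c" using \<epsilon>(1) by (simp add: c1_def)
  obtain \<rho> where \<rho>: "0 \<le> \<rho>" "\<rho> < 1" and
    bound: "\<And>n. n \<ge> 1 \<Longrightarrow> (\<integral>(u, v). char_mod p u v ^ n \<partial>torus) \<le> c1 / real n + \<rho> ^ n"
    using char_mod_integral_bound[OF p p_le_1 \<epsilon>(3,2)] unfolding c1_def by blast
  have "eventually (\<lambda>n. real n * \<rho> ^ n < c - c1) sequentially"
    using c1 \<rho> by (intro order_tendstoD(2)[OF powser_times_n_limit_0]) auto
  then obtain K where K: "\<And>n. n \<ge> K \<Longrightarrow> real n * \<rho> ^ n < c - c1"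
    by (auto simp: eventually_sequentially)
  have "free t n (point_mass h) y \<le> c / real n" if "n \<ge> max 1 K" for n t h y
  proof -
    have n: "n \<ge> 1" "n \<ge> K" using that by auto
    have "\<rho> ^ n \<le> (c - c1) / real n" using K[OF n(2)] n by (simp add: field_simps)
    then have "c1 / real n + \<rho> ^ n \<le> c / real n" by (simp add: diff_divide_distrib)
    then show ?thesis using free_point_mass_le[OF n(1)] bound[OF n(1)] by (meson order_trans)
  qed
  then show ?thesis by (intro exI[of _ "max 1 K"]) auto
qed

end

section \<open>Divergence of the expectation\<close>

context guided_walk
begin

lemma surv_pos:
  assumes "h \<noteq> 0" "0 < p"
  shows "0 < surv h 0 n 0"
proof -
  have "0 < ((p/4)^(4*1) / 2)^n" using assms by simp
  also have "\<dots> \<le> surv h 0 (n * (4*1 + 1)) 0" by (rule surv_geometric) (use assms in auto)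
  also have "\<dots> \<le> surv h 0 n 0" using assms by (intro surv_antimono) auto
  finally show ?thesis .
qed

lemma surv_not_summable:
  assumes h: "h \<noteq> 0" and p: "0 < p" and R: "4 < pi * p * sqrt (3 - 2*p) * R_poly p"
  shows "\<not> summable (\<lambda>n. surv h 0 n 0)"
proof -
  define a where "a n = surv h 0 n 0" for n
  define r2 where "r2 = 1/4 * p^2 + 1/2 * p * (1 - p)"
  define r4 where "r4 = 9/64 * p^4 + 9/16 * p^3 * (1 - p) + 3/8 * p^2 * (1 - p)^2"
  have r: "0 \<le> r2" "0 \<le> r4" using p_nonneg p_le_1 by (auto simp: r2_def r4_def)
  have R_eq: "R_poly p = 1 + r2 + r4" by (simp add: R_poly_def r2_def r4_def)
  have R_pos: "0 < 1 + r2 + r4" using r by simp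
  have "0 < pi * p * sqrt (3 - 2*p)" using p p_le_1 by simp
  then have "2 / (pi * p * sqrt (3 - 2*p)) < (1 + r2 + r4) / 2"
    using R unfolding R_eq by (simp add: field_simps)
  from local_limit_bound[OF p this] obtain K where K: "K \<ge> 1"
    "\<And>n t z. n \<ge> K \<Longrightarrow> free t n (point_mass h) z \<le> (1 + r2 + r4) / 2 / real n"
    by blast
  \<comment> \<open>\<open>l\<close> has the parity of \<open>h\<close>, so home can be hit only at
    times of the form \<open>2*j + l\<close>.\<close>
  define l :: nat where "l = (if even (fst h + snd h) then 0 else 1)"
  have l: "l \<le> 1" by (simp add: l_def)
  \<comment> \<open>With these weights, one decrement of \<open>B\<close> is a combination of three
    first-passage probabilities, to be matched with returns after 0, 2 and 4 steps.\<close>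
  define B where "B n = (a (2*n + l + 4) + r2 * a (2*n + l + 2) + r4 * a (2*n + l)) / (1 + r2 + r4)" for n
  have anti: "a n \<le> a m" if "m \<le> n" for m n
    unfolding a_def by (rule surv_antimono[OF h that])
  have B_ge: "a (2*n + l + 4) \<le> B n" for n
  proof -
    have "(1 + r2 + r4) * a (2*n + l + 4) \<le> a (2*n + l + 4) + r2 * a (2*n + l + 2) + r4 * a (2*n + l)"
      using r l unfolding distrib_right by (auto intro!: add_mono mult_left_mono anti)
    then show ?thesis using R_pos by (simp add: B_def pos_le_divide_eq mult.commute)
  qed
  have B_le: "B n \<le> a n" for n
  proof -
    have "a (2*n + l + 4) + r2 * a (2*n + l + 2) + r4 * a (2*n + l) \<le> (1 + r2 + r4) * a n"
      using r l unfolding distrib_right by (auto intro!: add_mono mult_left_mono anti)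
    then show ?thesis using R_pos by (simp add: B_def pos_divide_le_eq mult.commute)
  qed
  have B_pos: "0 < B n" for n
    using B_ge[of n] surv_pos[OF h p] unfolding a_def by (meson less_le_trans)
  have two_step: "a (2*j + l) - a (2*j + l + 2) = first h (2*j + l + 1)" for j
  proof -
    have "first h (2*j + l) = 0" by (rule first_parity) (simp add: l_def)
    then show ?thesis
      using surv_diff[of h "2*j + l"] surv_diff[of h "2*j + l + 1"] by (simp add: a_def)
  qed
  have "\<not> summable B"
  \<comment> \<open>This makes \<open>2 * m\<close> at least \<open>K\<close>, as the local bound
    requires, and keeps \<open>2*m - 5\<close> from being truncated.\<close>
  proof (rule delay_inequality_not_summable[where M = "K + 3"])
    show "0 < B n" for n by (rule B_pos)
    show "\<exists>n. C < B n * q ^ n" if q: "1 < q" for q C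
    proof -
      obtain n where "C < a (2*n + (l + 4)) * q ^ n"
        using surv_subexponential[OF h p q] unfolding a_def by blast
      also have "\<dots> \<le> B n * q ^ n"
        using B_ge[of n] q by (intro mult_right_mono) (auto simp: add.assoc)
      finally show ?thesis by blast
    qed
    fix n m :: nat assume m: "K + 3 \<le> m" "1 \<le> m" "m \<le> n"
    \<comment> \<open>The latest time that enters \<open>B (n - m)\<close>, so that
      \<open>a t \<le> B (n - m)\<close> by \<open>B_ge\<close>. The indices \<open>2*m - 1\<close>,
      \<open>2*m - 3\<close> and \<open>2*m - 5\<close> of \<open>?f\<close> leave 0, 2 and 4 steps
      for the return.\<close>
    define t where "t = 2*(n - m) + l + 4"
    let ?f = "\<lambda>i. first h (t + i) * free (t + i + 1) (2*m - 1 - i) (point_mass h) h"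
    have t: "t + (2*m - 1) = 2*(n + 1) + l + 1" "t + (2*m - 3) = 2*n + l + 1"
      "t + (2*m - 5) = 2*(n - 1) + l + 1"
      using m by (auto simp: t_def)
    have f1: "?f (2*m - 1) = a (2*(n+1) + l) - a (2*(n+1) + l + 2)"
      unfolding two_step t(1)[symmetric] by (simp add: point_mass_def)
    have f3: "r2 * (a (2*n + l) - a (2*n + l + 2)) \<le> ?f (2*m - 3)"
    proof -
      have "2*m - 1 - (2*m - 3) = 2" using m by simp
      then show ?thesis unfolding two_step t(2)[symmetric] r2_def
        using free_return_2 first_nonneg[OF h]
        by (simp only: mult.commute[of _ "first h _"] mult_left_mono)
    qed
    have f5: "r4 * (a (2*(n-1) + l) - a (2*(n-1) + l + 2)) \<le> ?f (2*m - 5)"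
    proof -
      have "2*m - 1 - (2*m - 5) = 4" using m by simp
      then show ?thesis unfolding two_step t(3)[symmetric] r4_def
        using free_return_4 first_nonneg[OF h]
        by (simp only: mult.commute[of _ "first h _"] mult_left_mono)
    qed
    have f_nonneg: "0 \<le> ?f i" for i
      by (intro mult_nonneg_nonneg first_nonneg h free_nonneg) (simp add: point_mass_def)
    have "B (n - 1) - B n = ((a (2*(n+1) + l) - a (2*(n+1) + l + 2))
        + r2 * (a (2*n + l) - a (2*n + l + 2))
        + r4 * (a (2*(n-1) + l) - a (2*(n-1) + l + 2))) / (1 + r2 + r4)"
    proof -
      have "2*(n-1) + l + 4 = 2*(n+1) + l" "2*(n-1) + l + 2 = 2*n + l"
        "2*n + l + 4 = 2*(n+1) + l + 2" "2*n + l + 2 = 2*(n+1) + l"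
        using m by auto
      then show ?thesis unfolding B_def diff_divide_distrib[symmetric]
        by (simp only:) (simp add: algebra_simps)
    qed
    also have "\<dots> \<le> (?f (2*m - 1) + ?f (2*m - 3) + ?f (2*m - 5)) / (1 + r2 + r4)"
      using f1 f3 f5 R_pos by (intro divide_right_mono) linarith+
    also have "?f (2*m - 1) + ?f (2*m - 3) + ?f (2*m - 5) = sum ?f {2*m - 1, 2*m - 3, 2*m - 5}"
    proof -
      have ne: "2*m - 1 \<noteq> 2*m - 3" "2*m - 1 \<noteq> 2*m - 5" "2*m - 3 \<noteq> 2*m - 5"
        using m by auto
      have "F (2*m - 1) + F (2*m - 3) + F (2*m - 5) = sum F {2*m - 1, 2*m - 3, 2*m - 5}"
        for F :: "nat \<Rightarrow> real"
        using ne by (simp add: add.assoc del: One_nat_def)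
      from this[of ?f] show ?thesis .
    qed
    also have "sum ?f {2*m - 1, 2*m - 3, 2*m - 5} \<le> sum ?f {..<2*m}"
      using m f_nonneg by (intro sum_mono2) auto
    also have "sum ?f {..<2*m} \<le> kill h 0 t (free t (2*m) (point_mass h)) 0"
      by (rule first_passage[OF h])
    also have "\<dots> \<le> a t * ((1 + r2 + r4) / 2 / real (2*m))"
      unfolding a_def using m by (intro kill_free_le h K) auto
    also have "\<dots> / (1 + r2 + r4) = a t / (4 * real m)"
    proof -
      have "A * (S / 2 / (2 * M)) / S = A / (4 * M)" if "0 < S" for A S M :: real
        using that by simp
      from this[OF R_pos, of "a t" "real m"] show ?thesis by simp
    qed
    also have "\<dots> \<le> B (n - m) / (4 * real m)"
      unfolding t_def by (intro divide_right_mono B_ge) auto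
    finally show "B (n - 1) - B n \<le> B (n - m) / (4 * real m)"
      using R_pos by (simp add: divide_right_mono)
  qed
  moreover have "norm (B n) \<le> a n" for n
    using B_le[of n] B_pos[of n] by (simp only: real_norm_def abs_of_pos)
  then have "summable B" if "summable a"
    by (rule summable_comparison_test'[OF that, of 0])
  ultimately show ?thesis unfolding a_def by blast
qed

end

subsection \<open>The probability space\<close>

lemma walk_pos_measurable:
  "(\<lambda>\<omega>. walk_pos \<omega> n) \<in> Pi\<^sub>M UNIV (\<lambda>t. measure_pmf (D t)) \<rightarrow>\<^sub>M count_space UNIV"
proof (induction n)
  case (Suc n)
  have "(\<lambda>\<omega>. vadd z (\<omega> n)) \<in> Pi\<^sub>M UNIV (\<lambda>t. measure_pmf (D t)) \<rightarrow>\<^sub>M count_space UNIV" for z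
    by (rule measurable_compose[OF measurable_component_singleton[of n]]) auto
  then show ?case
    using measurable_compose_countable[OF _ Suc, of "\<lambda>z \<omega>. vadd z (\<omega> n)"] by simp
qed simp

lemma walk_pos_fun_upd: "n \<le> m \<Longrightarrow> walk_pos (fun_upd \<omega> m d) n = walk_pos \<omega> n"
  by (induction n) auto

lemma vadd_eq: "vadd a b = a + b"
  by (simp add: vadd_def plus_prod_def)

text \<open>Resampling coordinate \<open>n\<close> independently preserves the product measure, and
  \<open>F\<close> ignores that coordinate in its first argument, so Fubini's theorem
  applies.\<close>

lemma nn_integral_PiM_component:
  fixes D :: "nat \<Rightarrow> 'a pmf"
  assumes F: "(\<lambda>z. F (snd z) (fst z)) \<in> borel_measurable (measure_pmf (D n) \<Otimes>\<^sub>M Pi\<^sub>M UNIV (\<lambda>t. measure_pmf (D t)))"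
    and indep: "\<And>\<omega> d e. F (fun_upd \<omega> n d) e = F \<omega> e"
    and F': "(\<lambda>\<omega>. F \<omega> (\<omega> n)) \<in> borel_measurable (Pi\<^sub>M UNIV (\<lambda>t. measure_pmf (D t)))"
  shows "(\<integral>\<^sup>+\<omega>. F \<omega> (\<omega> n) \<partial>Pi\<^sub>M UNIV (\<lambda>t. measure_pmf (D t)))
    = (\<integral>\<^sup>+\<omega>. \<integral>\<^sup>+d. F \<omega> d \<partial>measure_pmf (D n) \<partial>Pi\<^sub>M UNIV (\<lambda>t. measure_pmf (D t)))"
proof -
  let ?P = "Pi\<^sub>M UNIV (\<lambda>t. measure_pmf (D t))"
  interpret Q: prob_space ?P by (rule prob_space_PiM) (rule measure_pmf.prob_space_axioms)
  interpret pair_prob_space "measure_pmf (D n)" ?P ..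
  have P: "?P = distr (measure_pmf (D n) \<Otimes>\<^sub>M ?P) ?P (\<lambda>(x, X). fun_upd X n x)"
    using distr_pair_PiM_eq_PiM[of UNIV "\<lambda>t. measure_pmf (D t)" n]
    by (simp add: measure_pmf.prob_space_axioms)
  have meas: "(\<lambda>(x, X). fun_upd X n x) \<in> measure_pmf (D n) \<Otimes>\<^sub>M ?P \<rightarrow>\<^sub>M ?P"
    using measurable_fun_upd[of UNIV UNIV n snd "measure_pmf (D n) \<Otimes>\<^sub>M ?P" "\<lambda>t. measure_pmf (D t)" fst]
    by (simp add: split_beta)
  have "(\<integral>\<^sup>+\<omega>. F \<omega> (\<omega> n) \<partial>?P) = (\<integral>\<^sup>+z. F (snd z) (fst z) \<partial>(measure_pmf (D n) \<Otimes>\<^sub>M ?P))"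
  proof -
    have "(\<integral>\<^sup>+\<omega>. F \<omega> (\<omega> n) \<partial>?P)
        = (\<integral>\<^sup>+\<omega>. F \<omega> (\<omega> n) \<partial>distr (measure_pmf (D n) \<Otimes>\<^sub>M ?P) ?P (\<lambda>(x, X). fun_upd X n x))"
      using P by (rule arg_cong[where f = "\<lambda>M. \<integral>\<^sup>+\<omega>. F \<omega> (\<omega> n) \<partial>M"])
    also have "\<dots> = (\<integral>\<^sup>+z. F (snd z) (fst z) \<partial>(measure_pmf (D n) \<Otimes>\<^sub>M ?P))"
      using F' by (subst nn_integral_distr[OF meas]) (simp_all add: split_beta indep)
    finally show ?thesis .
  qed
  also have "\<dots> = (\<integral>\<^sup>+\<omega>. \<integral>\<^sup>+d. F \<omega> d \<partial>measure_pmf (D n) \<partial>?P)"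
    using nn_integral_snd[OF F] by simp
  finally show ?thesis .
qed

lemma nn_integral_step_pmf:
  fixes g :: "pt \<Rightarrow> real"
  assumes p: "0 \<le> p" "p \<le> 1" and x: "instructions x" and g: "\<And>z. 0 \<le> g z"
  shows "(\<integral>\<^sup>+d. ennreal (g (y + d)) \<partial>measure_pmf (step_pmf p x t))
    = ennreal (guided_walk.step p (\<lambda>t. vsub (x (Suc t)) (x t)) t g y)"
proof -
  interpret guided_walk p "\<lambda>t. vsub (x (Suc t)) (x t)"
    using p x by unfold_locales (auto simp: instructions_def)
  have ne: "unit_steps \<noteq> {}" by (simp add: unit_steps_def)
  have avg: "0 \<le> srw_avg g y" using srw_avg_mono[of "\<lambda>_. 0" y g] g by simp
  have "(\<integral>\<^sup>+d. ennreal (g (y + d)) \<partial>measure_pmf (pmf_of_set unit_steps)) = ennreal (srw_avg g y)"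
    using ne g by (simp add: nn_integral_pmf_of_set srw_avg_def sum_ennreal sum_nonneg
        divide_ennreal_def[symmetric] divide_ennreal[symmetric] ennreal_of_nat_eq_real_of_nat)
  then show ?thesis
    using p g avg
    by (simp add: step_pmf_def nn_integral_bind_pmf nn_integral_bernoulli_pmf step_def
        ennreal_mult[symmetric] ennreal_plus[symmetric] mult.commute del: ennreal_plus)
qed

text \<open>Links the recursion \<open>kill\<close> to the path measure. A general \<open>g\<close>
  is needed, since the induction replaces it by its image under the last step.\<close>

lemma killed_expectation:
  fixes g :: "pt \<Rightarrow> real"
  assumes p: "0 \<le> p" "p \<le> 1" and x: "instructions x" and g: "\<And>z. 0 \<le> g z"
  shows "(\<integral>\<^sup>+\<omega>. ennreal (g (walk_pos \<omega> n)) * indicator {\<omega>. \<forall>i<n. walk_pos \<omega> (Suc i) \<noteq> h} \<omega> \<partial>guided_space p x)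
    = ennreal (guided_walk.kill p (\<lambda>t. vsub (x (Suc t)) (x t)) h 0 n g 0)"
  using g
proof (induction n arbitrary: g)
  interpret guided_walk p "\<lambda>t. vsub (x (Suc t)) (x t)"
    using p x by unfold_locales (auto simp: instructions_def)
  interpret P: prob_space "guided_space p x"
    unfolding guided_space_def by (rule prob_space_PiM) (rule measure_pmf.prob_space_axioms)
  {
    case 0
    show ?case using P.emeasure_space_1 by (simp add: zero_prod_def)
  next
    case (Suc n)
    \<comment> \<open>\<open>G\<close> encodes avoidance at the last step, so that the remaining
      event \<open>A\<close> depends on the coordinates below \<open>n\<close> only.\<close>
    define G where "G z = (if z = h then 0 else g z)" for z
    have G: "0 \<le> G z" for z using Suc.prems by (simp add: G_def)
    define A where "A = {\<omega>. \<forall>i<n. walk_pos \<omega> (Suc i) \<noteq> h}"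
    define F where "F \<omega> d = ennreal (G (walk_pos \<omega> n + d)) * indicator A \<omega>" for \<omega> d
    note [measurable] = walk_pos_measurable
    have A [measurable]: "Measurable.pred (Pi\<^sub>M UNIV (\<lambda>t. measure_pmf (step_pmf p x t))) (\<lambda>\<omega>. \<omega> \<in> A)"
      unfolding A_def mem_Collect_eq by measurable
    \<comment> \<open>The lattice is countable, so measurability of the sum follows by fixing the
      value of \<open>f\<close>.\<close>
    have G_add: "(\<lambda>\<omega>. ennreal (G (f \<omega> + k \<omega>))) \<in> borel_measurable N"
      if "f \<in> N \<rightarrow>\<^sub>M count_space UNIV" "k \<in> N \<rightarrow>\<^sub>M count_space UNIV" for f k :: "'z \<Rightarrow> pt" and N
      using that
      by (intro measurable_compose_countable[of "\<lambda>a \<omega>. ennreal (G (a + k \<omega>))" N borel f])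
         (auto intro: measurable_compose[of k N "count_space UNIV"])
    have "(\<integral>\<^sup>+\<omega>. ennreal (g (walk_pos \<omega> (Suc n))) * indicator {\<omega>. \<forall>i<Suc n. walk_pos \<omega> (Suc i) \<noteq> h} \<omega> \<partial>guided_space p x)
        = (\<integral>\<^sup>+\<omega>. F \<omega> (\<omega> n) \<partial>guided_space p x)"
      by (intro nn_integral_cong)
         (auto simp: F_def A_def G_def vadd_eq less_Suc_eq indicator_def)
    also have "\<dots> = (\<integral>\<^sup>+\<omega>. \<integral>\<^sup>+d. F \<omega> d \<partial>measure_pmf (step_pmf p x n) \<partial>guided_space p x)"
      unfolding guided_space_def
    proof (rule nn_integral_PiM_component)
      show "F (fun_upd \<omega> n d) e = F \<omega> e" for \<omega> d e
        by (simp add: F_def A_def walk_pos_fun_upd indicator_def del: walk_pos.simps)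
      show "(\<lambda>z. F (snd z) (fst z)) \<in> borel_measurable
         (measure_pmf (step_pmf p x n) \<Otimes>\<^sub>M Pi\<^sub>M UNIV (\<lambda>t. measure_pmf (step_pmf p x t)))"
        unfolding F_def by (intro borel_measurable_times_ennreal G_add) measurable
      show "(\<lambda>\<omega>. F \<omega> (\<omega> n)) \<in> borel_measurable (Pi\<^sub>M UNIV (\<lambda>t. measure_pmf (step_pmf p x t)))"
        unfolding F_def by (intro borel_measurable_times_ennreal G_add) measurable
    qed
    also have "\<dots> = (\<integral>\<^sup>+\<omega>. ennreal (step n G (walk_pos \<omega> n)) * indicator A \<omega> \<partial>guided_space p x)"
      unfolding F_def using nn_integral_step_pmf[where g = G, OF p x G]
      by (simp add: nn_integral_multc)
    also have "\<dots> = ennreal (kill h 0 n (step n G) 0)"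
      unfolding A_def by (rule Suc.IH) (simp add: step_nonneg G)
    also have "kill h 0 n (step n G) 0 = kill h 0 (Suc n) g 0"
      unfolding kill_Suc' G_def by simp
    finally show ?case .
  }
qed

section \<open>From survival probabilities to the expectation\<close>

text \<open>The half of the tail-sum formula that bounds the expectation from below. A nonzero
  summand forces \<open>n\<close> to precede the first visit; time 0 causes no exception as
  \<open>h\<close> is not the origin.\<close>

lemma hitting_time_ge:
  assumes "h \<noteq> (0,0)"
  shows "(\<Sum>n<N. indicator {\<omega>. \<forall>i<n. walk_pos \<omega> (Suc i) \<noteq> h} \<omega>) \<le> hitting_time h \<omega>"
proof (cases "\<exists>n. walk_pos \<omega> n = h")
  case True
  define L where "L = (LEAST n. walk_pos \<omega> n = h)"
  have L: "walk_pos \<omega> L = h" unfolding L_def using True by (rule LeastI_ex)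
  have "n < L" if "\<forall>i<n. walk_pos \<omega> (Suc i) \<noteq> h" for n
  proof (rule ccontr)
    assume "\<not> n < L"
    with that L assms show False by (cases L) auto
  qed
  then have "(\<Sum>n<N. indicator {\<omega>. \<forall>i<n. walk_pos \<omega> (Suc i) \<noteq> h} \<omega>)
      \<le> (\<Sum>n<N. indicator {..<L} n :: ennreal)"
    by (intro sum_mono) (auto simp: indicator_def)
  also have "\<dots> = of_nat (card ({..<N} \<inter> {..<L}))"
    by (simp add: indicator_def sum.If_cases Int_def)
  also have "\<dots> \<le> of_nat (card {..<L})" by (intro of_nat_mono card_mono) auto
  also have "\<dots> = hitting_time h \<omega>" using True by (simp add: hitting_time_def L_def)
  finally show ?thesis .
qed (simp add: hitting_time_def)

theorem theorem1:
  fixes p :: real and x :: "nat \<Rightarrow> int \<times> int" and h :: "int \<times> int"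
  assumes "0 \<le> p" and "p \<le> 1" and "p > p1"
    and "instructions x"
    and "h \<noteq> (0,0)"
  shows "(\<integral>\<^sup>+ \<omega>. hitting_time h \<omega> \<partial>guided_space p x) = \<infinity>"
proof (rule ccontr)
  interpret guided_walk p "\<lambda>t. vsub (x (Suc t)) (x t)"
    using assms by unfold_locales (auto simp: instructions_def)
  let ?S = "\<lambda>n. {\<omega>. \<forall>i<n. walk_pos \<omega> (Suc i) \<noteq> h}"
  assume "(\<integral>\<^sup>+ \<omega>. hitting_time h \<omega> \<partial>guided_space p x) \<noteq> \<infinity>"
  then obtain r where r: "0 \<le> r" "(\<integral>\<^sup>+ \<omega>. hitting_time h \<omega> \<partial>guided_space p x) = ennreal r"
    by (metis ennreal_cases infinity_ennreal_def)
  have h: "h \<noteq> 0" using assms by (simp add: zero_prod_def)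
  \<comment> \<open>A finite expectation \<open>r\<close> would bound all partial sums, against
    \<open>surv_not_summable\<close>.\<close>
  have "(\<Sum>n<N. surv h 0 n 0) \<le> r" for N
  proof -
    note [measurable] = walk_pos_measurable
    have meas: "indicator (?S n) \<in> borel_measurable (guided_space p x)" for n
      unfolding guided_space_def indicator_def mem_Collect_eq by measurable
    have surv: "(\<integral>\<^sup>+\<omega>. indicator (?S n) \<omega> \<partial>guided_space p x) = ennreal (surv h 0 n 0)" for n
      using killed_expectation[where g = "\<lambda>_. 1" and x = x and p = p and h = h and n = n] assms by simp
    have "ennreal (\<Sum>n<N. surv h 0 n 0) = (\<Sum>n<N. \<integral>\<^sup>+\<omega>. indicator (?S n) \<omega> \<partial>guided_space p x)"
      unfolding surv using h by (intro sum_ennreal[symmetric] surv_nonneg) auto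
    also have "\<dots> = (\<integral>\<^sup>+\<omega>. (\<Sum>n<N. indicator (?S n) \<omega>) \<partial>guided_space p x)"
      by (rule nn_integral_sum[symmetric]) (rule meas)
    also have "\<dots> \<le> ennreal r"
      unfolding r(2)[symmetric] by (intro nn_integral_mono hitting_time_ge assms)
    finally show ?thesis using r(1) by simp
  qed
  then have "(\<Sum>n\<le>N. surv h 0 n 0) \<le> r" for N by (simp only: lessThan_Suc_atMost[symmetric])
  then have "summable (\<lambda>n. surv h 0 n 0)"
    using h by (intro bounded_imp_summable[of _ r]) (simp_all add: surv_nonneg)
  moreover have "threshold_fun p1 < threshold_fun p"
    by (rule threshold_fun_strict_mono) (use p1_root(1) assms in auto)
  then have "4 < threshold_fun p" using p1_root(3) by linarith
  ultimately show False
    using surv_not_summable[OF h] p1_root assms by (simp add: threshold_fun_def)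
qed

end
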